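(* Assume $\Lambda\neq\{0\}$. Let $(a,\delta)\in\overline K\times\Lambda$, let $\mu\in\mathcal V$ be the restriction of $v_{a,\delta}$ to $K[x]$, and let $B(a,\delta)=\bigsqcup_{i\in I}B^\circ(a_i,\delta)$ be the partition of $B(a,\delta)$ as a disjoint union of open balls of radius $\delta$. Then the tangent directions of $\mu$ are in one-to-one correspondence with the open balls of this partition up to the action of $\mathcal D$. Explicitly, let $\approx$ be the equivalence relation on $I$ given by $i\approx j$ if and only if $B^\circ(a_j,\delta)=\sigma(B^\circ(a_i,\delta))$ for some $\sigma\in\mathcal D$. Then the assignment $i\mapsto\operatorname{KP}_i(\mu)=p_K(\operatorname{Min}_K B^\circ(a_i,\delta))$ induces a bijection from $I/\!\approx$ onto the set $\{\mathbf t(\mu,\eta)\mid\eta\in\mathcal V,\ \mu<\eta\}$ of tangent directions of $\mu$.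
   Context: $(K,v)$ is a valued field, $\overline K$ an algebraic closure of $K$, and $v$ also denotes a fixed extension of $v$ to $\overline K$. Put $\Gamma=v\overline K$ and fix an embedding $\Gamma\hookrightarrow\Lambda$ into a divisible (totally) ordered abelian group $\Lambda$. $\mathcal V$ is the set of all $\Lambda$-valued valuations on $K(x)$ whose restriction to $K$ is $v$, identified with valuations $\mu:K[x]\to\Lambda\cup\{\infty\}$ with $\mu^{-1}(\infty)=\{0\}$ and $\mu_{\mid K}=v$. It is partially ordered by $\mu\le\eta$ iff $\mu(f)\le\eta(f)$ for all $f\in K[x]$; $\mu<\eta$ means $\mu\le\eta$ and $\mu\neq\eta$. For $(a,\delta)\in\overline K\times\Lambda$: $B(a,\delta)=\{b\in\overline K\mid v(b-a)\ge\delta\}$, $B^\circ(a,\delta)=\{b\in\overline K\mid v(b-a)>\delta\}$, and $v_{a,\delta}$ is the valuation on $\overline K[x]$ given by $v_{a,\delta}\left(\sum_k a_k(x-a)^k\right)=\min_k\{v(a_k)+k\delta\}$. For $c\in\overline K$, $p_K(c)\in K[x]$ is its minimal polynomial over $K$, and $\deg_K c=\deg p_K(c)$. For $S\subseteq\overline K$: $p_K(S)=\{p_K(c)\mid c\in S\}$, $\deg_K S=\min\{\deg_K c\mid c\in S\}$, $\operatorname{Min}_K S=\{c\in S\mid\deg_K c=\deg_K S\}$. $\mathcal D=\{\sigma\in\operatorname{Aut}(\overline K/K)\mid v\circ\sigma=v\}$ is the decomposition group of $v$. For $\mu<\eta$ in $\mathcal V$, the tangent direction $\mathbf t(\mu,\eta)$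 of $\mu$ determined by $\eta$ is the set of all monic polynomials $\phi\in K[x]$ of smallest degree satisfying $\mu(\phi)<\eta(\phi)$. *)

theory Defs
  imports "HOL-Computational_Algebra.Computational_Algebra" "HOL-Library.Disjoint_Sets"
begin

section \<open>Ordered groups with a point at infinity\<close>

datatype 'g with_inf = Val 'g | Infty

instantiation with_inf :: (linorder) linorder
begin

definition less_eq_with_inf :: "'a with_inf \<Rightarrow> 'a with_inf \<Rightarrow> bool" where
  "x \<le> y \<longleftrightarrow> (case y of Infty \<Rightarrow> True | Val b \<Rightarrow> (case x of Infty \<Rightarrow> False | Val a \<Rightarrow> a \<le> b))"

definition less_with_inf :: "'a with_inf \<Rightarrow> 'a with_inf \<Rightarrow> bool" where
  "x < y \<longleftrightarrow> (case x of Infty \<Rightarrow> False | Val a \<Rightarrow> (case y of Infty \<Rightarrow> True | Val b \<Rightarrow> a < b))"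

instance
  by standard (auto simp: less_eq_with_inf_def less_with_inf_def split: with_inf.splits)

end

instantiation with_inf :: (comm_monoid_add) comm_monoid_add
begin

definition zero_with_inf :: "'a with_inf" where
  "0 = Val 0"

definition plus_with_inf :: "'a with_inf \<Rightarrow> 'a with_inf \<Rightarrow> 'a with_inf" where
  "x + y = (case x of Infty \<Rightarrow> Infty | Val a \<Rightarrow> (case y of Infty \<Rightarrow> Infty | Val b \<Rightarrow> Val (a + b)))"

instance
  by standard (auto simp: plus_with_inf_def zero_with_inf_def ac_simps split: with_inf.splits)

end

definition nmult :: "nat \<Rightarrow> 'g::comm_monoid_add \<Rightarrow> 'g" where
  "nmult n g = (\<Sum>i<n. g)"

definition divisible_group :: "'g::ab_group_add itself \<Rightarrow> bool" where
  "divisible_group _ \<longleftrightarrow> (\<forall>n>0. \<forall>g::'g. \<exists>g'. nmult n g' = g)"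

section \<open>Algebraic closures and minimal polynomials\<close>

text \<open>
  An algebraic closure of a field \<open>'k\<close> is an algebraically closed field \<open>'l\<close> together with an
  embedding \<open>h\<close> over which \<open>'l\<close> is algebraic; \<open>K\<close> is identified with \<open>range h\<close>.
\<close>

definition is_alg_closure :: "('k::field \<Rightarrow> 'l::alg_closed_field) \<Rightarrow> bool" where
  "is_alg_closure h \<longleftrightarrow>
     h 1 = 1 \<and> (\<forall>x y. h (x + y) = h x + h y) \<and> (\<forall>x y. h (x * y) = h x * h y) \<and>
     (\<forall>c. \<exists>p. p \<noteq> 0 \<and> poly (map_poly h p) c = 0)"

definition minpoly :: "('k::field \<Rightarrow> 'l::field) \<Rightarrow> 'l \<Rightarrow> 'k poly" where
  "minpoly h c = (THE p. lead_coeff p = 1 \<and> poly (map_poly h p) c = 0 \<and>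
     (\<forall>q. q \<noteq> 0 \<and> poly (map_poly h q) c = 0 \<longrightarrow> degree p \<le> degree q))"

definition deg_over :: "('k::field \<Rightarrow> 'l::field) \<Rightarrow> 'l \<Rightarrow> nat" where
  "deg_over h c = degree (minpoly h c)"

definition set_deg_over :: "('k::field \<Rightarrow> 'l::field) \<Rightarrow> 'l set \<Rightarrow> nat" where
  "set_deg_over h S = (LEAST n. n \<in> deg_over h ` S)"

definition Min_over :: "('k::field \<Rightarrow> 'l::field) \<Rightarrow> 'l set \<Rightarrow> 'l set" where
  "Min_over h S = {c \<in> S. deg_over h c = set_deg_over h S}"

section \<open>Valuations\<close>

text \<open>
  The same notion serves for fields and for polynomial rings; on a polynomial ring over a field
  these are exactly the restrictions of the valuations of the field of rational functions.
\<close>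

definition valuation :: "('r::idom \<Rightarrow> 'g::linordered_ab_group_add with_inf) \<Rightarrow> bool" where
  "valuation w \<longleftrightarrow>
     (\<forall>x. w x = Infty \<longleftrightarrow> x = 0) \<and>
     (\<forall>x y. w (x * y) = w x + w y) \<and>
     (\<forall>x y. min (w x) (w y) \<le> w (x + y))"

text \<open>
  In the remaining definitions \<open>v\<close> is the valuation of the algebraic closure, already composed
  with the embedding of its value group; the valuation of \<open>'k\<close> is \<open>v \<circ> h\<close>.
  The order on \<open>valuations_over h v\<close> is the pointwise order of the function space.
\<close>

definition valuations_over ::
    "('k::field \<Rightarrow> 'l::field) \<Rightarrow> ('l \<Rightarrow> 'g::linordered_ab_group_add with_inf) \<Rightarrow>
     ('k poly \<Rightarrow> 'g with_inf) set" where
  "valuations_over h v = {\<mu>. valuation \<mu> \<and> (\<forall>c. \<mu> [:c:] = v (h c))}"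

definition vcball ::
    "('l::field \<Rightarrow> 'g::linordered_ab_group_add with_inf) \<Rightarrow> 'l \<Rightarrow> 'g \<Rightarrow> 'l set" where
  "vcball v a \<delta> = {b. v (b - a) \<ge> Val \<delta>}"

definition voball ::
    "('l::field \<Rightarrow> 'g::linordered_ab_group_add with_inf) \<Rightarrow> 'l \<Rightarrow> 'g \<Rightarrow> 'l set" where
  "voball v a \<delta> = {b. v (b - a) > Val \<delta>}"

text \<open>
  The coefficients of \<open>f\<close> in powers of \<open>x - a\<close> are the coefficients of \<open>f(x + a)\<close>.
\<close>

definition monomial_val ::
    "('l::field \<Rightarrow> 'g::linordered_ab_group_add with_inf) \<Rightarrow> 'l \<Rightarrow> 'g \<Rightarrow> 'l poly \<Rightarrow> 'g with_inf" where
  "monomial_val v a \<delta> f =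
     Min ((\<lambda>k. v (coeff (pcompose f [:a, 1:]) k) + Val (nmult k \<delta>)) ` {..degree f})"

lemma taylor_expansion:
  fixes f :: "'l::field poly"
  shows "(\<Sum>k\<le>degree f. smult (coeff (pcompose f [:a, 1:]) k) ([:-a, 1:] ^ k)) = f"
proof -
  let ?g = "pcompose f [:a, 1:]"
  have d: "degree ?g = degree f" by (simp add: degree_pcompose)
  have "pcompose ?g [:-a, 1:] = f"
    by (simp add: pcompose_assoc [symmetric] pcompose_pCons)
  moreover have "pcompose ?g [:-a, 1:] = (\<Sum>k\<le>degree ?g. smult (coeff ?g k) ([:-a, 1:] ^ k))"
    by (simp add: pcompose_altdef poly_altdef coeff_map_poly degree_map_poly)
  ultimately show ?thesis by (simp add: d)
qed

definition restrict_val ::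
    "('k::field \<Rightarrow> 'l::field) \<Rightarrow> ('l poly \<Rightarrow> 'g with_inf) \<Rightarrow> 'k poly \<Rightarrow> 'g with_inf" where
  "restrict_val h w f = w (map_poly h f)"

definition decomposition_group ::
    "('k::field \<Rightarrow> 'l::field) \<Rightarrow> ('l \<Rightarrow> 'g with_inf) \<Rightarrow> ('l \<Rightarrow> 'l) set" where
  "decomposition_group h v =
     {\<sigma>. bij \<sigma> \<and> (\<forall>x y. \<sigma> (x + y) = \<sigma> x + \<sigma> y) \<and> (\<forall>x y. \<sigma> (x * y) = \<sigma> x * \<sigma> y) \<and>
         (\<forall>c. \<sigma> (h c) = h c) \<and> v \<circ> \<sigma> = v}"

definition tangent_direction ::
    "('k::field poly \<Rightarrow> 'g::linorder with_inf) \<Rightarrow> ('k poly \<Rightarrow> 'g with_inf) \<Rightarrow> 'k poly set" where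
  "tangent_direction \<mu> \<eta> =
     {\<phi>. lead_coeff \<phi> = 1 \<and> \<mu> \<phi> < \<eta> \<phi> \<and>
         (\<forall>\<psi>. lead_coeff \<psi> = 1 \<and> \<mu> \<psi> < \<eta> \<psi> \<longrightarrow> degree \<phi> \<le> degree \<psi>)}"

end

theory Submission
  imports Defs
begin

text \<open>
  For \<open>\<mu>\<close> with centre \<open>a\<close> and radius \<open>\<delta>\<close>, enlarging the radius at a point \<open>c\<close> of the closed ball
  increases the value of exactly those polynomials that have a root in the open ball around \<open>c\<close>.
  Hence the polynomials of smallest degree with this property, which form a tangent direction, are
  the minimal polynomials of the points of smallest degree in this open ball.

  Conversely, let \<open>\<mu> < \<eta>\<close>. A polynomial \<open>f\<close> with \<open>\<mu> f < \<eta> f\<close> has a root in the closed ball: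
  otherwise \<open>f\<close> is congruent to the constant \<open>\<alpha> = f(a)\<close> modulo larger values of \<open>\<mu>\<close>, and an
  algebraic relation for \<open>\<alpha>\<close> yields a polynomial in \<open>f\<close> whose value under \<open>\<mu>\<close> exceeds that under
  \<open>\<eta>\<close>. Division with remainder by a member of a tangent direction shows that this member determines
  the whole direction, so the direction of \<open>\<eta>\<close> is the one given by the open ball around the root.

  If two open balls have the same minimal polynomials, choose points \<open>x\<close> and \<open>y\<close> of smallest degree
  in them with a common minimal polynomial. By the minimality of the degree, the isomorphism that maps
  \<open>x\<close> to \<open>y\<close> preserves the valuation, and by Zorn's lemma such isomorphisms extend to
  the algebraic closure.
\<close>

section \<open>Valuations\<close>

instance with_inf :: (linordered_ab_group_add) ordered_comm_monoid_add
  by standard (auto simp: less_eq_with_inf_def plus_with_inf_def split: with_inf.splits)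

lemma with_inf_simps [simp]:
  "Val a + Val b = Val (a + b)" "Infty + x = Infty" "x + Infty = Infty"
  "Val a \<le> Val b \<longleftrightarrow> a \<le> b" "Val a < Val b \<longleftrightarrow> a < b"
  "x \<le> Infty" "x < Infty \<longleftrightarrow> x \<noteq> Infty" "\<not> Infty < x" "Infty \<le> x \<longleftrightarrow> x = Infty"
  by (auto simp: less_eq_with_inf_def less_with_inf_def plus_with_inf_def zero_with_inf_def
      split: with_inf.splits)

lemma zero_neq_Infty [simp]: "0 \<noteq> Infty" "Infty \<noteq> 0"
  by (auto simp: zero_with_inf_def)

lemma Val_0 [simp]: "Val 0 = 0"
  by (simp add: zero_with_inf_def)

lemma plus_eq_Infty_iff [simp]:
  fixes x y :: "'g::linordered_ab_group_add with_inf"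
  shows "x + y = Infty \<longleftrightarrow> x = Infty \<or> y = Infty"
  by (cases x; cases y) auto

lemma with_inf_add_less_le_mono:
  fixes x y z u :: "'g::linordered_ab_group_add with_inf"
  assumes "x < y" "z \<le> u" "z \<noteq> Infty"
  shows "x + z < y + u"
  using assms by (cases x; cases y; cases z; cases u) (auto simp: add_less_le_mono)

lemma with_inf_add_le_less_mono:
  fixes x y z u :: "'g::linordered_ab_group_add with_inf"
  assumes "x \<le> y" "z < u" "x \<noteq> Infty"
  shows "x + z < y + u"
  using with_inf_add_less_le_mono[OF assms(2,1,3)] by (simp add: add.commute)

lemma with_inf_add_left_less_iff [simp]:
  fixes x y z :: "'g::linordered_ab_group_add with_inf"
  shows "z + x < z + y \<longleftrightarrow> x < y \<and> z \<noteq> Infty"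
  by (cases x; cases y; cases z) auto

lemma with_inf_add_left_cancel [simp]:
  fixes x y z :: "'g::linordered_ab_group_add with_inf"
  shows "z + x = z + y \<longleftrightarrow> x = y \<or> z = Infty"
  by (cases x; cases y; cases z) auto

text \<open>Finite elements are invertible. Moving \<open>Val (nmult n \<delta>)\<close> to the
  other side turns bounds on terms of an expansion into bounds on values of \<open>v\<close>, where
  the ultrametric inequality applies.\<close>

lemma le_Val_shift: "z \<le> x + Val d \<longleftrightarrow> z + Val (- d) \<le> x"
  and less_Val_shift: "z < x + Val d \<longleftrightarrow> z + Val (- d) < x"
  for x z :: "'g::linordered_ab_group_add with_inf"
  by (cases z; cases x; auto simp: algebra_simps)+

text \<open>Ordered groups are torsion free; applied to \<open>w (- 1)\<close>, this yields
  \<open>w (- x) = w x\<close>.\<close>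

lemma with_inf_double_zero:
  fixes x :: "'g::linordered_ab_group_add with_inf"
  shows "x + x = 0 \<longleftrightarrow> x = 0"
  by (cases x) (auto simp flip: Val_0)

lemma nmult_simps [simp]:
  "nmult 0 g = 0" "nmult (Suc n) g = g + nmult n g"
  by (simp_all add: nmult_def add.commute)

lemma nmult_add: "nmult (m + n) g = nmult m g + nmult n g"
  by (induction m) (simp_all add: add.assoc)

lemma nmult_mono:
  fixes g h :: "'g::linordered_ab_group_add"
  shows "g \<le> h \<Longrightarrow> nmult n g \<le> nmult n h"
  by (induction n) (auto intro: add_mono)

lemma nmult_strict_mono:
  fixes g h :: "'g::linordered_ab_group_add"
  shows "g < h \<Longrightarrow> 0 < n \<Longrightarrow> nmult n g < nmult n h"
proof (induction n)
  case (Suc n)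
  then show ?case by (cases n) (auto intro: add_strict_mono)
qed simp

section \<open>Ultrametric calculus\<close>

locale valued =
  fixes w :: "'r::idom \<Rightarrow> 'g::linordered_ab_group_add with_inf"
  assumes valuation: "valuation w"
begin

lemma eq_Infty_iff [simp]: "w x = Infty \<longleftrightarrow> x = 0"
  and mult: "w (x * y) = w x + w y"
  and add_ge: "min (w x) (w y) \<le> w (x + y)"
  using valuation unfolding valuation_def by blast+

lemma zero [simp]: "w 0 = Infty"
  by simp

lemma one [simp]: "w 1 = 0"
proof -
  have "w 1 + 0 = w 1 + w 1"
    using mult[of 1 1] by simp
  then show ?thesis
    by (metis eq_Infty_iff with_inf_add_left_cancel zero_neq_one)
qed

lemma minus [simp]: "w (- x) = w x"
proof -
  have "w (- 1) + w (- 1) = 0"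
    using mult[of "- 1" "- 1"] by simp
  then have "w (- 1) = 0"
    by (simp only: with_inf_double_zero)
  then show ?thesis
    using mult[of "- 1" x] by simp
qed

lemma minus_commute: "w (x - y) = w (y - x)"
  using minus[of "x - y"] by simp

lemma add_le: "z \<le> w x \<Longrightarrow> z \<le> w y \<Longrightarrow> z \<le> w (x + y)"
  using add_ge[of x y] by (metis min_le_iff_disj order_trans)

lemma add_less: "z < w x \<Longrightarrow> z < w y \<Longrightarrow> z < w (x + y)"
  using add_ge[of x y] by (metis min_le_iff_disj less_le_trans)

lemma diff_le: "z \<le> w x \<Longrightarrow> z \<le> w y \<Longrightarrow> z \<le> w (x - y)"
  using add_le[of z x "- y"] by simp

lemma diff_less: "z < w x \<Longrightarrow> z < w y \<Longrightarrow> z < w (x - y)"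
  using add_less[of z x "- y"] by simp

lemma add_eq:
  assumes "w x < w y"
  shows "w (x + y) = w x"
proof (rule antisym)
  show "w (x + y) \<le> w x"
    using add_less[of "w x" "x + y" "- y"] assms by (auto simp flip: not_less)
  show "w x \<le> w (x + y)"
    using add_le[of "w x" x y] assms by simp
qed

lemma sum_le: "(\<And>i. i \<in> A \<Longrightarrow> z \<le> w (f i)) \<Longrightarrow> z \<le> w (sum f A)"
  by (induction A rule: infinite_finite_induct) (auto intro: add_le)

lemma sum_less: "z \<noteq> Infty \<Longrightarrow> (\<And>i. i \<in> A \<Longrightarrow> z < w (f i)) \<Longrightarrow> z < w (sum f A)"
  by (induction A rule: infinite_finite_induct) (auto intro: add_less)

text \<open>The term of strictly smallest value cannot be cancelled. A one-element \<open>A\<close>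
  is treated separately because \<open>f i\<close> may then be zero.\<close>

lemma sum_eq:
  assumes "finite A" "i \<in> A" "\<And>j. j \<in> A \<Longrightarrow> j \<noteq> i \<Longrightarrow> w (f i) < w (f j)"
  shows "w (sum f A) = w (f i)"
proof (cases "A = {i}")
  case False
  then obtain j where "j \<in> A" "j \<noteq> i" using assms(2) by blast
  then have "w (f i) \<noteq> Infty" using assms(3) by (metis with_inf_simps(8))
  then have "w (f i) < w (sum f (A - {i}))"
    using assms(3) by (intro sum_less) auto
  then show ?thesis
    using assms(1,2) add_eq by (simp add: sum.remove)
qed simp

end

subsection \<open>Monomial valuations\<close>

text \<open>These are the entries of the minimum in \<open>monomial_val\<close>, but for every index
  \<open>k\<close>; beyond the degree they equal \<open>Infty\<close>, which keeps degree bounds out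
  of the later arguments.\<close>

definition monomial_term ::
    "('l::field \<Rightarrow> 'g::linordered_ab_group_add with_inf) \<Rightarrow> 'l \<Rightarrow> 'g \<Rightarrow> 'l poly \<Rightarrow> nat \<Rightarrow> 'g with_inf"
  where "monomial_term v a \<delta> f k = v (coeff (pcompose f [:a, 1:]) k) + Val (nmult k \<delta>)"

lemma degree_shift [simp]: "degree (pcompose f [:a, 1:]) = degree f" for f :: "'l::field poly"
  by (simp add: degree_pcompose)

lemma shift_eq_0_iff [simp]: "pcompose f [:a, 1:] = 0 \<longleftrightarrow> f = 0" for f :: "'l::field poly"
  by (simp add: pcompose_eq_0_iff)

locale valued_field = valued v for v :: "'l::field \<Rightarrow> 'g::linordered_ab_group_add with_inf"
begin

abbreviation "tm \<equiv> monomial_term v"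
abbreviation "mv \<equiv> monomial_val v"

lemma tm_above_degree: "k > degree f \<Longrightarrow> tm a \<delta> f k = Infty"
  by (simp add: monomial_term_def coeff_eq_0)

lemma tm_Infty_iff: "tm a \<delta> f k = Infty \<longleftrightarrow> coeff (pcompose f [:a, 1:]) k = 0"
  by (simp add: monomial_term_def)

lemma mv_Min: "mv a \<delta> f = Min (tm a \<delta> f ` {..degree f})"
  by (simp add: monomial_val_def monomial_term_def)

lemma mv_le_tm: "mv a \<delta> f \<le> tm a \<delta> f k"
  by (cases "k \<le> degree f") (simp_all add: mv_Min tm_above_degree)

lemma mv_attained: "\<exists>k. mv a \<delta> f = tm a \<delta> f k"
proof -
  have "Min (tm a \<delta> f ` {..degree f}) \<in> tm a \<delta> f ` {..degree f}"
    by (intro Min_in) auto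
  then obtain k where "Min (tm a \<delta> f ` {..degree f}) = tm a \<delta> f k"
    by (rule imageE)
  then show ?thesis by (auto simp: mv_Min)
qed

lemma mv_greatest: "(\<And>k. z \<le> tm a \<delta> f k) \<Longrightarrow> z \<le> mv a \<delta> f"
  using mv_attained by metis

lemma mv_Infty_iff [simp]: "mv a \<delta> f = Infty \<longleftrightarrow> f = 0"
proof
  assume "mv a \<delta> f = Infty"
  then have "coeff (pcompose f [:a, 1:]) k = 0" for k
    using mv_le_tm[of a \<delta> f k] by (simp add: tm_Infty_iff)
  then have "pcompose f [:a, 1:] = 0" by (intro poly_eqI) auto
  then show "f = 0" by simp
next
  assume "f = 0"
  then show "mv a \<delta> f = Infty"
    using mv_attained[of a \<delta> f] by (auto simp: tm_Infty_iff monomial_term_def)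
qed

lemma tm_convolution:
  assumes "i \<le> n"
  shows "v (coeff (pcompose f [:a, 1:]) i * coeff (pcompose g [:a, 1:]) (n - i)) + Val (nmult n \<delta>)
    = tm a \<delta> f i + tm a \<delta> g (n - i)"
proof -
  have "nmult n \<delta> = nmult i \<delta> + nmult (n - i) \<delta>"
    using assms by (simp flip: nmult_add)
  then have "Val (nmult n \<delta>) = Val (nmult i \<delta>) + Val (nmult (n - i) \<delta>)"
    by simp
  then show ?thesis
    by (simp add: monomial_term_def mult ac_simps del: with_inf_simps(1))
qed

lemma tm_mult:
  "tm a \<delta> (f * g) n =
    v (\<Sum>i\<le>n. coeff (pcompose f [:a, 1:]) i * coeff (pcompose g [:a, 1:]) (n - i)) + Val (nmult n \<delta>)"
  by (simp add: monomial_term_def pcompose_mult coeff_mult)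

lemma tm_mult_ge:
  assumes "\<And>i. i \<le> n \<Longrightarrow> z \<le> tm a \<delta> f i + tm a \<delta> g (n - i)"
  shows "z \<le> tm a \<delta> (f * g) n"
  unfolding tm_mult le_Val_shift using assms
  by (intro sum_le) (simp flip: le_Val_shift add: tm_convolution)

lemma tm_mult_gt:
  assumes "z \<noteq> Infty" "\<And>i. i \<le> n \<Longrightarrow> z < tm a \<delta> f i + tm a \<delta> g (n - i)"
  shows "z < tm a \<delta> (f * g) n"
  unfolding tm_mult less_Val_shift using assms
  by (intro sum_less) (simp_all flip: less_Val_shift add: tm_convolution)

text \<open>The coefficient of a product is a convolution; if the pair \<open>(k, l)\<close> gives
  the only summand of smallest value, nothing cancels it.\<close>

lemma tm_mult_eq:
  assumes "\<And>i. i \<le> k + l \<Longrightarrow> i \<noteq> k \<Longrightarrow> tm a \<delta> f k + tm a \<delta> g l < tm a \<delta> f i + tm a \<delta> g (k + l - i)"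
  shows "tm a \<delta> (f * g) (k + l) = tm a \<delta> f k + tm a \<delta> g l"
proof -
  let ?c = "\<lambda>i. coeff (pcompose f [:a, 1:]) i * coeff (pcompose g [:a, 1:]) (k + l - i)"
  have "v (sum ?c {..k + l}) = v (?c k)"
  proof (rule sum_eq)
    fix i assume i: "i \<in> {..k + l}" "i \<noteq> k"
    have "v (?c k) + Val (nmult (k + l) \<delta>) < v (?c i) + Val (nmult (k + l) \<delta>)"
      using assms[of i] i tm_convolution[of i "k + l" f a g \<delta>] tm_convolution[of k "k + l" f a g \<delta>] by simp
    then show "v (?c k) < v (?c i)"
      by (metis add.commute with_inf_add_left_less_iff)
  qed auto
  then show ?thesis
    using tm_convolution[of k "k + l" f a g \<delta>] by (simp add: tm_mult)
qed

text \<open>Gauss's lemma: the ultrametric inequality bounds the value of the product from below,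
  and no cancellation occurs where the first terms of minimal value are multiplied.\<close>

lemma mv_mult: "mv a \<delta> (f * g) = mv a \<delta> f + mv a \<delta> g"
proof (cases "f = 0 \<or> g = 0")
  case True
  moreover have "mv a \<delta> 0 = Infty" by simp
  ultimately show ?thesis by (elim disjE) (simp_all del: mv_Infty_iff)
next
  case False
  define k where "k = (LEAST k. tm a \<delta> f k = mv a \<delta> f)"
  define l where "l = (LEAST k. tm a \<delta> g k = mv a \<delta> g)"
  have k: "tm a \<delta> f k = mv a \<delta> f"
    unfolding k_def by (rule LeastI_ex) (metis mv_attained)
  have l: "tm a \<delta> g l = mv a \<delta> g"
    unfolding l_def by (rule LeastI_ex) (metis mv_attained)
  have k': "mv a \<delta> f < tm a \<delta> f i" if "i < k" for i
    using not_less_Least[OF that[unfolded k_def]] mv_le_tm[of a \<delta> f i]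
    by (auto simp: order.strict_iff_order)
  have l': "mv a \<delta> g < tm a \<delta> g i" if "i < l" for i
    using not_less_Least[OF that[unfolded l_def]] mv_le_tm[of a \<delta> g i]
    by (auto simp: order.strict_iff_order)
  have "tm a \<delta> (f * g) (k + l) = tm a \<delta> f k + tm a \<delta> g l"
  proof (rule tm_mult_eq)
    \<comment> \<open>Any other summand has its first index below \<open>k\<close> or its second
      below \<open>l\<close>, and terms before the first minimal one are strictly larger.\<close>
    fix i assume i: "i \<le> k + l" "i \<noteq> k"
    show "tm a \<delta> f k + tm a \<delta> g l < tm a \<delta> f i + tm a \<delta> g (k + l - i)"
    proof (cases "i < k")
      case True
      then show ?thesis
        unfolding k l using False by (intro with_inf_add_less_le_mono k' mv_le_tm) simp_all
    next
      case ge: False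
      then have "k + l - i < l" using i by linarith
      then show ?thesis
        unfolding k l using False by (intro with_inf_add_le_less_mono l' mv_le_tm) simp_all
    qed
  qed
  then have "mv a \<delta> (f * g) \<le> mv a \<delta> f + mv a \<delta> g"
    using mv_le_tm[of a \<delta> "f * g" "k + l"] k l by simp
  moreover have "mv a \<delta> f + mv a \<delta> g \<le> mv a \<delta> (f * g)"
    by (intro mv_greatest tm_mult_ge add_mono mv_le_tm)
  ultimately show ?thesis by (rule antisym)
qed

lemma valuation_mv: "valuation (mv a \<delta>)"
  unfolding valuation_def
proof (intro conjI allI)
  fix f g :: "'l poly"
  show "min (mv a \<delta> f) (mv a \<delta> g) \<le> mv a \<delta> (f + g)"
  proof (rule mv_greatest)
    fix k
    have "min (mv a \<delta> f) (mv a \<delta> g) \<le> min (tm a \<delta> f k) (tm a \<delta> g k)"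
      using mv_le_tm by (meson min.mono)
    also have "\<dots> \<le> tm a \<delta> (f + g) k"
      unfolding monomial_term_def le_Val_shift pcompose_add coeff_add
      by (intro add_le) (simp_all flip: le_Val_shift)
    finally show "min (mv a \<delta> f) (mv a \<delta> g) \<le> tm a \<delta> (f + g) k" .
  qed
qed (simp_all add: mv_mult)

sublocale mv: valued "mv a \<delta>" for a \<delta>
  by standard (rule valuation_mv)

lemma mv_const [simp]: "mv a \<delta> [:c:] = v c"
  by (simp add: mv_Min monomial_term_def)

lemma mv_linear [simp]: "mv a \<delta> [:- r, 1:] = min (v (a - r)) (Val \<delta>)"
proof -
  have "{..Suc 0} = {0, 1}" by auto
  then show ?thesis
    by (simp add: mv_Min monomial_term_def pcompose_pCons)
qed

lemma mv_mono: "\<delta> \<le> \<epsilon> \<Longrightarrow> mv a \<delta> f \<le> mv a \<epsilon> f"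
proof (rule mv_greatest)
  fix k assume "\<delta> \<le> \<epsilon>"
  then have "tm a \<delta> f k \<le> tm a \<epsilon> f k"
    unfolding monomial_term_def by (intro add_left_mono) (simp add: nmult_mono)
  then show "mv a \<delta> f \<le> tm a \<epsilon> f k"
    using mv_le_tm order_trans by blast
qed

subsection \<open>Polynomials with a dominant term\<close>

text \<open>For nonzero \<open>f\<close> over an algebraically closed field this expresses that no
  root \<open>r\<close> satisfies \<open>v (a - r) = Val \<delta>\<close>; \<open>k\<close> then
  counts the roots with \<open>v (a - r)\<close> larger.\<close>

definition dominant :: "'l \<Rightarrow> 'g \<Rightarrow> 'l poly \<Rightarrow> nat \<Rightarrow> bool" where
  "dominant a \<delta> f k \<longleftrightarrow> (\<forall>j. j \<noteq> k \<longrightarrow> tm a \<delta> f k < tm a \<delta> f j)"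

lemma dominant_tm: "dominant a \<delta> f k \<Longrightarrow> tm a \<delta> f k = mv a \<delta> f"
  by (metis dominant_def mv_attained mv_le_tm not_less)

text \<open>Among all pairs of indices, \<open>(k, l)\<close> is the unique one of smallest total
  value, so it prevails in its own convolution and lies below every summand of the others.\<close>

lemma dominant_mult:
  assumes "dominant a \<delta> f k" "dominant a \<delta> g l"
  shows "dominant a \<delta> (f * g) (k + l)"
proof -
  \<comment> \<open>Being strictly below another term makes both dominant terms finite, so that
    strict inequalities survive addition.\<close>
  have nz: "tm a \<delta> f k \<noteq> Infty" "tm a \<delta> g l \<noteq> Infty"
    using assms by (metis dominant_def n_not_Suc_n with_inf_simps(8))+
  have less: "tm a \<delta> f k + tm a \<delta> g l < tm a \<delta> f i + tm a \<delta> g j" if "i \<noteq> k \<or> j \<noteq> l" for i j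
  proof (cases "i = k")
    case True
    then show ?thesis using that assms(2) nz by (simp add: dominant_def)
  next
    case False
    then show ?thesis
      using assms(1) nz mv_le_tm[of a \<delta> g j] dominant_tm[OF assms(2)]
      by (intro with_inf_add_less_le_mono) (auto simp: dominant_def)
  qed
  have eq: "tm a \<delta> (f * g) (k + l) = tm a \<delta> f k + tm a \<delta> g l"
    by (rule tm_mult_eq) (use less in auto)
  show ?thesis
    unfolding dominant_def eq
  proof (intro allI impI tm_mult_gt less)
    fix i j assume "j \<noteq> k + l" "i \<le> j"
    then show "i \<noteq> k \<or> j - i \<noteq> l" by auto
  qed (use nz in auto)
qed

end

subsection \<open>Roots and monomial valuations\<close>

text \<open>Roots are split off one at a time, so statements compatible with products reduce to
  constants and factors \<open>[:- r, 1:]\<close>.\<close>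

lemma alg_closed_poly_induct [case_names const linear]:
  fixes f :: "'l::alg_closed_field poly"
  assumes const: "\<And>c. P [:c:]"
    and linear: "\<And>r f. f \<noteq> 0 \<Longrightarrow> P f \<Longrightarrow> P ([:- r, 1:] * f)"
  shows "P f"
proof (induction "degree f" arbitrary: f)
  case 0
  then show ?case using const by (metis degree_eq_zeroE)
next
  case (Suc n)
  then obtain r where "poly f r = 0"
    using alg_closed_imp_poly_has_root[of f] by auto
  then obtain g where g: "f = [:- r, 1:] * g"
    by (auto simp: poly_eq_0_iff_dvd)
  have "g \<noteq> 0" using Suc.hyps(2) g by auto
  then have "degree f = Suc (degree g)"
    unfolding g by (subst degree_mult_eq) auto
  then show ?case
    using Suc.hyps linear \<open>g \<noteq> 0\<close> unfolding g by simp
qed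

text \<open>Nonzero arguments have finite values, hence a sum increases exactly if one summand does.
  This reduces comparisons to linear factors.\<close>

lemma valuation_less_mult_iff:
  assumes "valuation \<mu>" "valuation \<eta>" "\<And>f. \<mu> f \<le> \<eta> f" "f \<noteq> 0" "g \<noteq> 0"
  shows "\<mu> (f * g) < \<eta> (f * g) \<longleftrightarrow> \<mu> f < \<eta> f \<or> \<mu> g < \<eta> g"
proof -
  interpret \<mu>: valued \<mu> by standard fact
  interpret \<eta>: valued \<eta> by standard fact
  show ?thesis
  proof
    assume "\<mu> f < \<eta> f \<or> \<mu> g < \<eta> g"
    then show "\<mu> (f * g) < \<eta> (f * g)"
      unfolding \<mu>.mult \<eta>.mult using assms(3-5)
      by (elim disjE) (simp_all add: with_inf_add_less_le_mono with_inf_add_le_less_mono)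
  next
    assume *: "\<mu> (f * g) < \<eta> (f * g)"
    show "\<mu> f < \<eta> f \<or> \<mu> g < \<eta> g"
    proof (rule ccontr)
      assume "\<not> (\<mu> f < \<eta> f \<or> \<mu> g < \<eta> g)"
      then have "\<mu> f = \<eta> f" "\<mu> g = \<eta> g"
        using assms(3) by (auto simp: order.strict_iff_order)
      then show False using * by (simp add: \<mu>.mult \<eta>.mult)
    qed
  qed
qed

locale valued_alg_closed = valued_field v
  for v :: "'l::alg_closed_field \<Rightarrow> 'g::linordered_ab_group_add with_inf"
begin

section \<open>Dependence of monomial valuations on centre and radius\<close>

lemma min_v_center:
  assumes "Val \<delta> \<le> v (a - c)"
  shows "min (v (a - r)) (Val \<delta>) = min (v (c - r)) (Val \<delta>)"
proof -
  have "Val \<delta> \<le> v (c - r) \<longleftrightarrow> Val \<delta> \<le> v (a - r)"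
    using add_le[of "Val \<delta>" "a - c" "c - r"] diff_le[of "Val \<delta>" "a - r" "a - c"] assms by auto
  moreover have "v (a - r) = v (c - r)" if "v (c - r) < Val \<delta>"
    using add_eq[of "c - r" "a - c"] that assms by simp
  ultimately show ?thesis
    by (auto simp: min_def not_le)
qed

text \<open>Both sides are multiplicative. For a linear factor, moving the centre within the closed
  ball can change \<open>v (a - r)\<close> only where it is at least \<open>Val \<delta>\<close>,
  and there the minimum hides the change.\<close>

lemma mv_center:
  assumes "Val \<delta> \<le> v (a - c)"
  shows "mv a \<delta> f = mv c \<delta> f"
proof (induction f rule: alg_closed_poly_induct)
  case (linear r f)
  then show ?case using min_v_center[OF assms] by (simp only: mv_mult mv_linear)
qed simp

text \<open>A linear factor has the value \<open>min (v (a - r)) (Val \<delta>)\<close>, which grows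
  with the radius exactly if \<open>r\<close> lies in the open ball. Multiplicativity does the
  rest.\<close>

lemma mv_less_iff:
  assumes "\<delta> < \<epsilon>"
  shows "mv a \<delta> f < mv a \<epsilon> f \<longleftrightarrow> f \<noteq> 0 \<and> (\<exists>r\<in>voball v a \<delta>. poly f r = 0)"
proof (induction f rule: alg_closed_poly_induct)
  case (const c)
  then show ?case by auto
next
  case (linear r f)
  have "mv a \<delta> [:- r, 1:] < mv a \<epsilon> [:- r, 1:] \<longleftrightarrow> Val \<delta> < v (a - r)"
    using assms by (cases "v (a - r)") (auto simp: min_def)
  then have "mv a \<delta> [:- r, 1:] < mv a \<epsilon> [:- r, 1:] \<longleftrightarrow> r \<in> voball v a \<delta>"
    by (simp add: voball_def minus_commute)
  then have "mv a \<delta> ([:- r, 1:] * f) < mv a \<epsilon> ([:- r, 1:] * f) \<longleftrightarrow>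
    r \<in> voball v a \<delta> \<or> (\<exists>r\<in>voball v a \<delta>. poly f r = 0)"
    using linear assms
    by (subst valuation_less_mult_iff) (auto simp: valuation_mv mv_mono)
  then show ?case using linear by auto
qed

text \<open>For a root \<open>r\<close> outside the open ball, the minimum that gives the value of
  the linear factor is attained by \<open>v (a - r)\<close>.\<close>

lemma mv_eq_v_poly:
  assumes "\<And>r. r \<in> voball v a \<delta> \<Longrightarrow> poly f r \<noteq> 0"
  shows "mv a \<delta> f = v (poly f a)"
  using assms
proof (induction f rule: alg_closed_poly_induct)
  case (linear r f)
  have "r \<notin> voball v a \<delta>" using linear.prems by fastforce
  then have "v (a - r) \<le> Val \<delta>"
    by (simp add: voball_def minus_commute not_less)
  then have "mv a \<delta> [:- r, 1:] = v (a - r)"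
    by (simp add: min_def)
  moreover have "mv a \<delta> f = v (poly f a)"
    using linear.IH linear.prems by simp
  ultimately show ?case
    by (simp only: mv_mult) (simp add: mult[symmetric] algebra_simps)
qed simp

lemma dominant_const: "c \<noteq> 0 \<Longrightarrow> dominant a \<delta> [:c:] 0"
  by (auto simp: dominant_def monomial_term_def coeff_pCons split: nat.splits)

lemma dominant_linear:
  "v (a - r) < Val \<delta> \<Longrightarrow> dominant a \<delta> [:- r, 1:] 0"
  "Val \<delta> < v (a - r) \<Longrightarrow> dominant a \<delta> [:- r, 1:] 1"
  by (auto simp: dominant_def monomial_term_def coeff_pCons pcompose_pCons split: nat.splits)

text \<open>Every linear factor has its root outside the closed ball and hence a dominant constant
  term; under products the dominant indices add up.\<close>

lemma dominant_0_if_no_root: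
  assumes "f \<noteq> 0" "\<And>r. r \<in> vcball v a \<delta> \<Longrightarrow> poly f r \<noteq> 0"
  shows "dominant a \<delta> f 0"
  using assms
proof (induction f rule: alg_closed_poly_induct)
  case (const c)
  then show ?case by (simp add: dominant_const)
next
  case (linear r f)
  have "r \<notin> vcball v a \<delta>" using linear.prems by fastforce
  then have "v (a - r) < Val \<delta>"
    by (simp add: vcball_def minus_commute not_le)
  then show ?case
    using dominant_mult[of a \<delta> "[:- r, 1:]" 0 f 0] linear by (simp add: dominant_linear)
qed

text \<open>Subtracting the constant removes exactly the dominant term of index 0 from the expansion
  at \<open>a\<close>; all remaining terms are strictly larger.\<close>

lemma mv_diff_const:
  assumes "f \<noteq> 0" "\<And>r. r \<in> vcball v a \<delta> \<Longrightarrow> poly f r \<noteq> 0"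
  shows "v (poly f a) < mv a \<delta> (f - [:poly f a:])"
proof -
  have dom: "dominant a \<delta> f 0"
    using assms by (rule dominant_0_if_no_root)
  have "a \<in> vcball v a \<delta>" by (simp add: vcball_def)
  then have nz: "poly f a \<noteq> 0" by (rule assms(2))
  obtain k where k: "mv a \<delta> (f - [:poly f a:]) = tm a \<delta> (f - [:poly f a:]) k"
    using mv_attained by blast
  show ?thesis
  proof (cases k)
    case 0
    then show ?thesis using k nz by (simp add: monomial_term_def pcompose_diff)
  next
    case (Suc n)
    then have "tm a \<delta> (f - [:poly f a:]) k = tm a \<delta> f k"
      by (simp add: monomial_term_def pcompose_diff)
    moreover have "tm a \<delta> f 0 = v (poly f a)"
      by (simp add: monomial_term_def)
    ultimately show ?thesis
      using dom k Suc by (simp add: dominant_def)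
  qed
qed

text \<open>A dominant term at value \<open>\<gamma>\<close> is visible from the values of the coefficients alone. This
  replaces the Newton polygon in comparing the values of the roots of two polynomials.\<close>

lemma dominant_if_no_root_of_value:
  assumes "f \<noteq> 0" "\<And>r. poly f r = 0 \<Longrightarrow> v r \<noteq> Val \<gamma>"
  shows "\<exists>k. dominant 0 \<gamma> f k"
  using assms
proof (induction f rule: alg_closed_poly_induct)
  case (const c)
  then show ?case using dominant_const by auto
next
  case (linear r f)
  have "v (0 - r) \<noteq> Val \<gamma>" using linear.prems(2)[of r] by simp
  then obtain k where "dominant 0 \<gamma> [:- r, 1:] k"
    using dominant_linear[where a = 0 and r = r and \<delta> = \<gamma>] by (metis linorder_neqE)
  moreover obtain l where "dominant 0 \<gamma> f l"
    using linear by fastforce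
  ultimately show ?case using dominant_mult by blast
qed

lemma v_power: "v y = Val \<gamma> \<Longrightarrow> v (y ^ k) = Val (nmult k \<gamma>)"
  by (induction k) (simp_all add: mult)

text \<open>Dominance depends only on the values of the coefficients. If no root of
  \<open>f'\<close> had the value \<open>\<gamma>\<close> of \<open>y\<close>, a term would dominate
  in \<open>f'\<close>, hence also in \<open>f\<close>, and \<open>poly f y\<close> would have its
  finite value instead of being zero.\<close>

lemma root_of_equal_value:
  assumes coeffs: "\<And>k. v (coeff f k) = v (coeff f' k)"
    and "f \<noteq> 0" "poly f y = 0"
  obtains y' where "poly f' y' = 0" "v y' = v y"
proof (cases "y = 0")
  case True
  then have "coeff f 0 = 0" using assms(3) by (simp add: poly_0_coeff_0)
  then have "coeff f' 0 = 0" using coeffs[of 0] by (metis eq_Infty_iff)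
  then show ?thesis using True that[of 0] by (simp add: poly_0_coeff_0)
next
  case False
  then obtain \<gamma> where \<gamma>: "v y = Val \<gamma>"
    by (metis eq_Infty_iff with_inf.exhaust)
  have "\<exists>y'. poly f' y' = 0 \<and> v y' = Val \<gamma>"
  proof (rule ccontr)
    assume none: "\<not> ?thesis"
    have "f' \<noteq> 0"
      using \<open>f \<noteq> 0\<close> coeffs by (metis coeff_0 eq_Infty_iff leading_coeff_0_iff)
    then obtain k where "dominant 0 \<gamma> f' k"
      using dominant_if_no_root_of_value none by blast
    then have dom: "tm 0 \<gamma> f k < tm 0 \<gamma> f j" if "j \<noteq> k" for j
      using that coeffs by (simp add: dominant_def monomial_term_def)
    have term_eq: "v (coeff f j * y ^ j) = tm 0 \<gamma> f j" for j
      by (simp add: monomial_term_def mult v_power \<gamma>)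
    have "tm 0 \<gamma> f k < Infty"
      using dom[of "Suc k"] by (metis n_not_Suc_n with_inf_simps(7,8))
    then have "k \<le> degree f"
      using tm_above_degree by (metis not_le with_inf_simps(8))
    then have "v (\<Sum>j\<le>degree f. coeff f j * y ^ j) = tm 0 \<gamma> f k"
      by (subst sum_eq[where i = k]) (auto simp: term_eq dom)
    moreover have "(\<Sum>j\<le>degree f. coeff f j * y ^ j) = 0"
      using assms(3) by (simp add: poly_altdef)
    ultimately show False
      using \<open>tm 0 \<gamma> f k < Infty\<close> by simp
  qed
  then show ?thesis using that \<gamma> by auto
qed

end

section \<open>Minimal polynomials\<close>

locale alg_closure =
  fixes h :: "'k::field \<Rightarrow> 'l::alg_closed_field"
  assumes is_alg_closure: "is_alg_closure h"
begin

lemma h_1 [simp]: "h 1 = 1"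
  and h_add: "h (x + y) = h x + h y"
  and h_mult: "h (x * y) = h x * h y"
  and algebraic: "\<exists>p. p \<noteq> 0 \<and> poly (map_poly h p) c = 0"
  using is_alg_closure unfolding is_alg_closure_def by blast+

lemma h_0 [simp]: "h 0 = 0"
  using h_add[of 0 0] by (metis add_0 add_right_cancel)

lemma h_minus: "h (- x) = - h x"
  using h_add[of x "- x"] by (simp add: eq_neg_iff_add_eq_0 add.commute)

lemma h_diff: "h (x - y) = h x - h y"
  using h_add[of x "- y"] by (simp add: h_minus)

lemma h_eq_0_iff [simp]: "h x = 0 \<longleftrightarrow> x = 0"
proof
  assume "h x = 0"
  then have "h (x * inverse x) = 0" by (simp add: h_mult)
  then show "x = 0" by (cases "x = 0") auto
qed simp

abbreviation H :: "'k poly \<Rightarrow> 'l poly" where "H \<equiv> map_poly h"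

lemma coeff_H [simp]: "coeff (H p) i = h (coeff p i)"
  by (simp add: coeff_map_poly)

lemma degree_H [simp]: "degree (H p) = degree p"
  by (simp add: degree_map_poly)

lemma H_eq_0_iff [simp]: "H p = 0 \<longleftrightarrow> p = 0"
  by (simp add: map_poly_eq_0_iff)

lemma H_pCons [simp]: "H (pCons a p) = pCons (h a) (H p)"
  by (simp add: map_poly_pCons)

lemma H_add: "H (p + q) = H p + H q"
  by (intro poly_eqI) (simp add: h_add)

lemma H_diff: "H (p - q) = H p - H q"
  by (intro poly_eqI) (simp add: h_diff)

lemma H_smult: "H (smult a p) = smult (h a) (H p)"
  by (intro poly_eqI) (simp add: h_mult)

lemma H_mult: "H (p * q) = H p * H q"
  by (induction p) (simp_all add: H_add H_smult)

lemma H_pcompose: "H (pcompose p q) = pcompose (H p) (H q)"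
  by (induction p) (simp_all add: pcompose_pCons H_add H_mult)

lemma minpoly_exists:
  "\<exists>p. lead_coeff p = 1 \<and> poly (H p) c = 0 \<and>
     (\<forall>q. q \<noteq> 0 \<and> poly (H q) c = 0 \<longrightarrow> degree p \<le> degree q)"
proof -
  obtain p where p: "p \<noteq> 0" "poly (H p) c = 0"
    and min: "\<And>q. q \<noteq> 0 \<Longrightarrow> poly (H q) c = 0 \<Longrightarrow> degree p \<le> degree q"
    using ex_has_least_nat[of "\<lambda>p. p \<noteq> 0 \<and> poly (H p) c = 0" _ degree] algebraic[of c]
    by metis
  let ?p = "smult (inverse (lead_coeff p)) p"
  have "lead_coeff ?p = 1" "poly (H ?p) c = 0" "degree ?p = degree p"
    using p by (simp_all add: H_smult)
  then show ?thesis using min by metis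
qed

text \<open>The difference of two monic polynomials of the same minimal degree loses its leading
  term and keeps the root \<open>c\<close>, so it vanishes.\<close>

lemma minpoly_unique:
  assumes "lead_coeff p = 1" "poly (H p) c = 0"
    and "\<And>q. q \<noteq> 0 \<Longrightarrow> poly (H q) c = 0 \<Longrightarrow> degree p \<le> degree q"
    and "lead_coeff p' = 1" "poly (H p') c = 0"
    and "\<And>q. q \<noteq> 0 \<Longrightarrow> poly (H q) c = 0 \<Longrightarrow> degree p' \<le> degree q"
  shows "p = p'"
proof (rule ccontr)
  assume "p \<noteq> p'"
  then have "degree p \<le> degree (p - p')"
    using assms by (intro assms(3)) (auto simp: H_diff)
  moreover have deg: "degree p' = degree p"
    using assms by (metis antisym leading_coeff_0_iff zero_neq_one)
  have "degree (p - p') \<le> degree p"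
    using deg by (intro degree_diff_le) auto
  moreover have "coeff (p - p') (degree p) = 0"
    using assms deg by simp
  ultimately have "p - p' = 0"
    by (metis antisym leading_coeff_0_iff)
  then show False using \<open>p \<noteq> p'\<close> by simp
qed

lemma minpoly_eqI:
  assumes "lead_coeff p = 1" "poly (H p) c = 0"
    and "\<And>q. q \<noteq> 0 \<Longrightarrow> poly (H q) c = 0 \<Longrightarrow> degree p \<le> degree q"
  shows "minpoly h c = p"
  unfolding minpoly_def
proof (rule the_equality)
  fix p' assume "lead_coeff p' = 1 \<and> poly (H p') c = 0 \<and>
    (\<forall>q. q \<noteq> 0 \<and> poly (H q) c = 0 \<longrightarrow> degree p' \<le> degree q)"
  then show "p' = p"
    using assms by (intro minpoly_unique[of p' c p]) auto
qed (use assms in auto)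

lemma minpoly_monic [simp]: "lead_coeff (minpoly h c) = 1"
  and minpoly_root [simp]: "poly (H (minpoly h c)) c = 0"
  and minpoly_minimal: "q \<noteq> 0 \<Longrightarrow> poly (H q) c = 0 \<Longrightarrow> degree (minpoly h c) \<le> degree q"
  using minpoly_exists[of c] minpoly_eqI by metis+

lemma minpoly_nonzero [simp]: "minpoly h c \<noteq> 0"
  using minpoly_monic[of c] by (metis leading_coeff_0_iff zero_neq_one)

text \<open>Otherwise the variable could be divided out, leaving a polynomial of smaller degree with
  the root \<open>c\<close>. The nonzero constant coefficient later expresses inverses as
  polynomials.\<close>

lemma minpoly_coeff_0:
  assumes "c \<noteq> 0"
  shows "coeff (minpoly h c) 0 \<noteq> 0"
proof
  assume *: "coeff (minpoly h c) 0 = 0"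
  obtain a q where q: "minpoly h c = pCons a q" by (rule pCons_cases)
  then have "a = 0" using * by simp
  moreover have "q \<noteq> 0" using q \<open>a = 0\<close> minpoly_nonzero[of c] by auto
  moreover have "poly (H q) c = 0"
    using minpoly_root[of c] q \<open>a = 0\<close> assms by simp
  ultimately show False
    using minpoly_minimal[of q c] q by simp
qed

section \<open>Partial isomorphisms\<close>

text \<open>A partial isomorphism between subfields of \<open>'l\<close> is represented by its graph. Since \<open>'l\<close> is
  algebraic over \<open>'k\<close>, closure under inverses is automatic.\<close>

definition ring_graph :: "('l \<times> 'l) set \<Rightarrow> bool" where
  "ring_graph S \<longleftrightarrow> (\<forall>k. (h k, h k) \<in> S) \<and>
     (\<forall>x x' y y'. (x, x') \<in> S \<longrightarrow> (y, y') \<in> S \<longrightarrow> (x + y, x' + y') \<in> S \<and> (x * y, x' * y') \<in> S)"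

text \<open>Applied to differences, the condition on zeros makes the relation single-valued and
  injective.\<close>

definition field_graph :: "('l \<times> 'l) set \<Rightarrow> bool" where
  "field_graph S \<longleftrightarrow> ring_graph S \<and> (\<forall>x x'. (x, x') \<in> S \<longrightarrow> (x = 0 \<longleftrightarrow> x' = 0))"

definition poly_pair :: "('l \<times> 'l) set \<Rightarrow> 'l poly \<Rightarrow> 'l poly \<Rightarrow> bool" where
  "poly_pair S f f' \<longleftrightarrow> (\<forall>i. (coeff f i, coeff f' i) \<in> S)"

lemma ring_graph_h: "ring_graph S \<Longrightarrow> (h k, h k) \<in> S"
  and ring_graph_add: "ring_graph S \<Longrightarrow> (x, x') \<in> S \<Longrightarrow> (y, y') \<in> S \<Longrightarrow> (x + y, x' + y') \<in> S"
  and ring_graph_mult: "ring_graph S \<Longrightarrow> (x, x') \<in> S \<Longrightarrow> (y, y') \<in> S \<Longrightarrow> (x * y, x' * y') \<in> S"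
  by (simp_all add: ring_graph_def)

lemma ring_graph_0: "ring_graph S \<Longrightarrow> (0, 0) \<in> S"
  using ring_graph_h[of S 0] by simp

lemma ring_graph_1: "ring_graph S \<Longrightarrow> (1, 1) \<in> S"
  using ring_graph_h[of S 1] by simp

lemma ring_graph_minus: "ring_graph S \<Longrightarrow> (x, x') \<in> S \<Longrightarrow> (- x, - x') \<in> S"
  using ring_graph_mult[of S "h (- 1)" "h (- 1)" x x'] ring_graph_h[of S "- 1"] by (simp add: h_minus)

lemma ring_graph_diff:
  "ring_graph S \<Longrightarrow> (x, x') \<in> S \<Longrightarrow> (y, y') \<in> S \<Longrightarrow> (x - y, x' - y') \<in> S"
  using ring_graph_add[of S x x' "- y" "- y'"] ring_graph_minus[of S y y'] by simp

lemma ring_graph_sum: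
  assumes "ring_graph S" "\<And>i. i \<in> A \<Longrightarrow> (f i, f' i) \<in> S"
  shows "(sum f A, sum f' A) \<in> S"
  using assms(2) by (induction A rule: infinite_finite_induct)
    (auto intro: ring_graph_0 ring_graph_add assms(1))

lemma ring_graph_power:
  "ring_graph S \<Longrightarrow> (x, x') \<in> S \<Longrightarrow> (x ^ n, x' ^ n) \<in> S"
  by (induction n) (auto intro: ring_graph_1 ring_graph_mult)

lemma field_graphD:
  "field_graph S \<Longrightarrow> ring_graph S"
  "field_graph S \<Longrightarrow> (x, x') \<in> S \<Longrightarrow> x = 0 \<longleftrightarrow> x' = 0"
  by (auto simp: field_graph_def)

context
  fixes S :: "('l \<times> 'l) set"
  assumes S: "ring_graph S"
begin

lemma poly_pair_const: "(x, x') \<in> S \<Longrightarrow> poly_pair S [:x:] [:x':]"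
  using S by (auto simp: poly_pair_def coeff_pCons ring_graph_0 split: nat.splits)

lemma poly_pair_0: "poly_pair S 0 0"
  using S by (simp add: poly_pair_def ring_graph_0)

lemma poly_pair_1: "poly_pair S 1 1"
  using poly_pair_const[OF ring_graph_1[OF S]] by (simp add: one_pCons)

lemma poly_pair_X: "poly_pair S [:0, 1:] [:0, 1:]"
  using S by (auto simp: poly_pair_def coeff_pCons ring_graph_0 ring_graph_1 split: nat.splits)

lemma poly_pair_pCons:
  "poly_pair S (pCons x f) (pCons x' f') \<longleftrightarrow> (x, x') \<in> S \<and> poly_pair S f f'"
  unfolding poly_pair_def coeff_pCons by (force split: nat.splits)

lemma poly_pair_add: "poly_pair S f f' \<Longrightarrow> poly_pair S g g' \<Longrightarrow> poly_pair S (f + g) (f' + g')"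
  using S by (simp add: poly_pair_def ring_graph_add)

lemma poly_pair_diff: "poly_pair S f f' \<Longrightarrow> poly_pair S g g' \<Longrightarrow> poly_pair S (f - g) (f' - g')"
  using S by (simp add: poly_pair_def ring_graph_diff)

lemma poly_pair_mult: "poly_pair S f f' \<Longrightarrow> poly_pair S g g' \<Longrightarrow> poly_pair S (f * g) (f' * g')"
  using S unfolding poly_pair_def coeff_mult by (auto intro!: ring_graph_sum ring_graph_mult)

lemma poly_pair_smult: "(x, x') \<in> S \<Longrightarrow> poly_pair S g g' \<Longrightarrow> poly_pair S (smult x g) (smult x' g')"
  using S by (simp add: poly_pair_def ring_graph_mult)

lemma poly_pair_power: "poly_pair S f f' \<Longrightarrow> poly_pair S (f ^ n) (f' ^ n)"
  by (induction n) (auto intro: poly_pair_1 poly_pair_mult)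

lemma poly_pair_H: "poly_pair S (H q) (H q)"
  using S by (simp add: poly_pair_def ring_graph_h)

lemma poly_pair_pcompose_H:
  "poly_pair S f f' \<Longrightarrow> poly_pair S (pcompose (H q) f) (pcompose (H q) f')"
  by (induction q)
    (auto simp: pcompose_pCons intro!: poly_pair_0 poly_pair_add poly_pair_mult poly_pair_const
      ring_graph_h S)

lemma poly_pair_poly:
  assumes "poly_pair S f f'" "(y, y') \<in> S"
  shows "(poly f y, poly f' y') \<in> S"
proof -
  \<comment> \<open>In a mere \<open>ring_graph\<close> a nonzero coefficient may be related to
    zero, so the degrees may differ.\<close>
  let ?n = "max (degree f) (degree f')"
  have "poly f y = (\<Sum>i\<le>?n. coeff f i * y ^ i)" "poly f' y' = (\<Sum>i\<le>?n. coeff f' i * y' ^ i)"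
    unfolding poly_altdef by (intro sum.mono_neutral_left; auto simp: coeff_eq_0)+
  then show ?thesis
    using assms S by (auto simp: poly_pair_def intro!: ring_graph_sum ring_graph_mult ring_graph_power)
qed

end

lemma poly_pair_mono: "S \<subseteq> T \<Longrightarrow> poly_pair S f f' \<Longrightarrow> poly_pair T f f'"
  by (auto simp: poly_pair_def)

context
  fixes S :: "('l \<times> 'l) set"
  assumes fg: "field_graph S"
begin

lemmas rg = field_graphD(1)[OF fg]

text \<open>Elements of \<open>K\<close> are related to themselves, so \<open>poly (H q) x\<close>
  is related to \<open>poly (H q) x'\<close>. In particular, related elements are conjugate over
  \<open>K\<close>.\<close>

lemma field_graph_algebraic_root:
  assumes "(x, x') \<in> S" "poly (H q) x = 0"
  shows "poly (H q) x' = 0"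
  using field_graphD(2)[OF fg poly_pair_poly[OF rg poly_pair_H[OF rg] assms(1)]] assms(2) by simp

text \<open>Writing the minimal polynomial of \<open>x\<close> as \<open>a + X * q\<close> with
  \<open>a \<noteq> 0\<close> gives \<open>inverse x = - q(x) / a\<close>; the same formula holds
  for \<open>x'\<close>, a root of the same polynomial.\<close>

lemma field_graph_inverse:
  assumes "(x, x') \<in> S"
  shows "(inverse x, inverse x') \<in> S"
proof (cases "x = 0")
  case True
  then show ?thesis using assms field_graphD(2)[OF fg assms] by simp
next
  case False
  then have "x' \<noteq> 0" using field_graphD(2)[OF fg assms] by simp
  obtain a q where q: "minpoly h x = pCons a q" by (rule pCons_cases)
  then have "a \<noteq> 0" using minpoly_coeff_0[OF False] by simp
  have "h a + x * poly (H q) x = 0"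
    using minpoly_root[of x] q by simp
  moreover have "h a + x' * poly (H q) x' = 0"
    using field_graph_algebraic_root[OF assms minpoly_root] q by simp
  ultimately have "x * poly (H q) x = h (- a)" "x' * poly (H q) x' = h (- a)"
    by (simp_all add: h_minus eq_neg_iff_add_eq_0 add.commute)
  moreover have "h (- a) * h (inverse (- a)) = 1"
    using \<open>a \<noteq> 0\<close> by (simp flip: h_mult)
  ultimately have "x * (poly (H q) x * h (inverse (- a))) = 1"
    "x' * (poly (H q) x' * h (inverse (- a))) = 1"
    by (simp_all flip: mult.assoc)
  then have "inverse x = poly (H q) x * h (inverse (- a))"
    "inverse x' = poly (H q) x' * h (inverse (- a))"
    by (simp_all add: inverse_unique)
  then show ?thesis
    using ring_graph_mult[OF rg poly_pair_poly[OF rg poly_pair_H[OF rg] assms] ring_graph_h[OF rg]]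
    by simp
qed

lemma field_graph_divide:
  "(x, x') \<in> S \<Longrightarrow> (y, y') \<in> S \<Longrightarrow> (x / y, x' / y') \<in> S"
  unfolding divide_inverse by (intro ring_graph_mult[OF rg] field_graph_inverse)

lemma poly_pair_eq_0_iff: "poly_pair S f f' \<Longrightarrow> f = 0 \<longleftrightarrow> f' = 0"
  unfolding poly_pair_def poly_eq_iff using field_graphD(2)[OF fg] by auto

lemma poly_pair_degree:
  assumes "poly_pair S f f'"
  shows "degree f = degree f'"
proof -
  have "(coeff f i = 0) = (coeff f' i = 0)" for i
    using assms field_graphD(2)[OF fg] unfolding poly_pair_def by blast
  then show ?thesis
    unfolding degree_def by simp
qed

text \<open>The induction follows long division coefficient by coefficient. Only field operations on
  coefficients occur, and related divisors have equal degree.\<close>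

lemma poly_pair_div_mod:
  assumes g: "poly_pair S g g'" and f: "poly_pair S f f'"
  shows "poly_pair S (f div g) (f' div g') \<and> poly_pair S (f mod g) (f' mod g')"
proof (cases "g = 0")
  case True
  then show ?thesis
    using assms poly_pair_eq_0_iff[OF g] poly_pair_0[OF rg] by simp
next
  case False
  then have "g' \<noteq> 0" using poly_pair_eq_0_iff[OF g] by simp
  show ?thesis
    using f
  proof (induction f arbitrary: f')
    case 0
    then show ?case using poly_pair_eq_0_iff[of 0 f'] poly_pair_0[OF rg] by simp
  next
    case (pCons x f F')
    obtain x' f' where F': "F' = pCons x' f'" by (rule pCons_cases)
    have x: "(x, x') \<in> S" and f: "poly_pair S f f'"
      using pCons.prems unfolding F' poly_pair_pCons[OF rg] by auto
    define b where "b = coeff (pCons x (f mod g)) (degree g) / lead_coeff g"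
    define b' where "b' = coeff (pCons x' (f' mod g')) (degree g') / lead_coeff g'"
    have IH: "poly_pair S (f div g) (f' div g')" "poly_pair S (f mod g) (f' mod g')"
      using pCons.IH[OF f] by auto
    have r: "poly_pair S (pCons x (f mod g)) (pCons x' (f' mod g'))"
      using IH x by (simp add: poly_pair_pCons[OF rg])
    have "(b, b') \<in> S"
      using r g poly_pair_degree[OF g] unfolding b_def b'_def
      by (auto simp: poly_pair_def intro!: field_graph_divide)
    moreover have "pCons x f div g = pCons b (f div g)" "F' div g' = pCons b' (f' div g')"
      using False \<open>g' \<noteq> 0\<close> by (simp_all add: div_pCons_eq b_def b'_def F')
    moreover have "pCons x f mod g = pCons x (f mod g) - smult b g"
      "F' mod g' = pCons x' (f' mod g') - smult b' g'"
      using False \<open>g' \<noteq> 0\<close> unfolding F' by (simp_all add: mod_pCons b_def b'_def)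
    ultimately show ?case
      using IH r g by (simp add: poly_pair_pCons[OF rg] poly_pair_diff[OF rg] poly_pair_smult[OF rg])
  qed
qed

text \<open>Running the Euclidean algorithm simultaneously on both sides transfers common roots.\<close>

lemma poly_pair_common_root:
  assumes "poly_pair S f f'" "poly_pair S g g'" "poly f b = 0" "poly g b = 0"
  shows "\<exists>b'. poly f' b' = 0 \<and> poly g' b' = 0"
  using assms
proof (induction "if g = 0 then 0 else Suc (degree g)" arbitrary: f f' g g' rule: less_induct)
  case less
  show ?case
  proof (cases "g = 0")
    case True
    then have "g' = 0" using poly_pair_eq_0_iff less.prems by blast
    show ?thesis
    proof (cases "f = 0")
      case True
      then have "f' = 0" using poly_pair_eq_0_iff less.prems by blast
      then show ?thesis using \<open>g' = 0\<close> by simp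
    next
      case False
      then have "degree f' > 0"
        using less.prems poly_pair_degree[of f f'] by (auto elim!: degree_eq_zeroE intro!: gr0I)
      then show ?thesis using \<open>g' = 0\<close> alg_closed_imp_poly_has_root[of f'] by auto
    qed
  next
    case False
    then have "degree g > 0" using less.prems(4) by (metis degree_eq_zeroE not_gr_zero poly_const_conv pCons_0_0)
    then have smaller: "(if f mod g = 0 then 0 else Suc (degree (f mod g)))
        < (if g = 0 then 0 else Suc (degree g))"
      using degree_mod_less[OF False, of f] False by auto
    have "poly_pair S (f mod g) (f' mod g')"
      using poly_pair_div_mod less.prems by blast
    moreover have "poly (f mod g) b = 0"
      using less.prems(3,4) by (metis add_0 div_mult_mod_eq mult_zero_right poly_add poly_mult)
    ultimately obtain b' where b': "poly g' b' = 0" "poly (f' mod g') b' = 0"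
      using less.hyps[OF smaller, of g g' "f' mod g'"] less.prems by blast
    then have "poly f' b' = 0"
      by (metis add_0 div_mult_mod_eq mult_zero_right poly_add poly_mult)
    then show ?thesis using b' by blast
  qed
qed

section \<open>Simple extensions of partial isomorphisms\<close>

text \<open>Up to a scalar, \<open>m\<close> is the minimal polynomial of \<open>y\<close> over the
  domain of \<open>S\<close>. Divisibility is required on the image side, because there it makes the
  extension sending \<open>y\<close> to a root of \<open>m'\<close> well defined.\<close>

definition relative_minpoly :: "'l \<Rightarrow> 'l poly \<Rightarrow> 'l poly \<Rightarrow> bool" where
  "relative_minpoly y m m' \<longleftrightarrow> m \<noteq> 0 \<and> poly_pair S m m' \<and> poly m y = 0 \<and>
     (\<forall>q q'. poly_pair S q q' \<and> poly q y = 0 \<longrightarrow> m' dvd q')"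

text \<open>The choice is one of least degree; the minimal polynomial over \<open>K\<close> is a
  candidate. Dividing simultaneously on both sides, a zero remainder for \<open>m\<close> gives a
  zero remainder for \<open>m'\<close>.\<close>

lemma relative_minpoly_exists: "\<exists>m m'. relative_minpoly y m m'"
proof -
  define P where "P m \<longleftrightarrow> m \<noteq> 0 \<and> poly m y = 0 \<and> (\<exists>m'. poly_pair S m m')" for m
  have "P (H (minpoly h y))"
    using poly_pair_H[OF rg] by (auto simp: P_def)
  then obtain m where m: "P m" and min: "\<And>q. P q \<Longrightarrow> degree m \<le> degree q"
    using ex_has_least_nat[of P _ degree] by blast
  obtain m' where m': "poly_pair S m m'" using m by (auto simp: P_def)
  have "m' dvd q'" if q: "poly_pair S q q'" "poly q y = 0" for q q'
  proof -
    have r: "poly_pair S (q mod m) (q' mod m')" "poly (q mod m) y = 0"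
      using poly_pair_div_mod[OF m' q(1)] m q(2)
      by (auto simp: P_def) (metis add_0 div_mult_mod_eq mult_zero_right poly_add poly_mult)
    have "q mod m = 0"
    proof (rule ccontr)
      assume "q mod m \<noteq> 0"
      then have "degree (q mod m) < degree m"
        using degree_mod_less[of m q] m by (auto simp: P_def)
      moreover have "P (q mod m)"
        using r \<open>q mod m \<noteq> 0\<close> by (auto simp: P_def)
      ultimately show False using min by (meson not_less)
    qed
    then have "q' mod m' = 0" using poly_pair_eq_0_iff[OF r(1)] by simp
    then show ?thesis by (simp add: mod_eq_0_iff_dvd)
  qed
  then show ?thesis using m m' by (auto simp: P_def relative_minpoly_def)
qed

end

text \<open>This is the relation \<open>q(y) \<mapsto> q'(y')\<close>. For a
  \<open>ring_graph\<close> it is closed under the ring operations, but it is a partial isomorphism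
  only for suitable \<open>y'\<close>.\<close>

definition adjoin :: "('l \<times> 'l) set \<Rightarrow> 'l \<Rightarrow> 'l \<Rightarrow> ('l \<times> 'l) set" where
  "adjoin S y y' = {(poly q y, poly q' y') | q q'. poly_pair S q q'}"

lemma adjoinI: "poly_pair S q q' \<Longrightarrow> (poly q y, poly q' y') \<in> adjoin S y y'"
  by (auto simp: adjoin_def)

lemma
  assumes S: "ring_graph S"
  shows adjoin_superset: "S \<subseteq> adjoin S y y'"
    and adjoin_generator: "(y, y') \<in> adjoin S y y'"
    and ring_graph_adjoin: "ring_graph (adjoin S y y')"
proof -
  show super: "S \<subseteq> adjoin S y y'"
  proof
    fix z assume "z \<in> S"
    then show "z \<in> adjoin S y y'"
      using adjoinI[OF poly_pair_const[OF S], of "fst z" "snd z" y y'] by simp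
  qed
  show "(y, y') \<in> adjoin S y y'"
    using adjoinI[OF poly_pair_X[OF S], of y y'] by simp
  show "ring_graph (adjoin S y y')"
    unfolding ring_graph_def
  proof (intro conjI allI impI)
    fix x x' z z' assume "(x, x') \<in> adjoin S y y'" "(z, z') \<in> adjoin S y y'"
    then obtain f f' g g' where *: "poly_pair S f f'" "poly_pair S g g'"
      and eq: "x = poly f y" "x' = poly f' y'" "z = poly g y" "z' = poly g' y'"
      by (auto simp: adjoin_def)
    show "(x + z, x' + z') \<in> adjoin S y y'"
      using adjoinI[OF poly_pair_add[OF S *]] by (simp add: eq)
    show "(x * z, x' * z') \<in> adjoin S y y'"
      using adjoinI[OF poly_pair_mult[OF S *]] by (simp add: eq)
  qed (use super ring_graph_h[OF S] in auto)
qed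

text \<open>If \<open>q(y) = 0\<close>, then \<open>m'\<close> divides \<open>q'\<close>.
  Conversely, the minimal polynomial of \<open>x = q(y)\<close> over \<open>K\<close>, composed with
  \<open>q\<close>, vanishes at \<open>y\<close>; transferred to \<open>y'\<close> with
  \<open>q'(y') = 0\<close>, this makes its constant coefficient zero, so
  \<open>x = 0\<close>.\<close>

lemma field_graph_adjoin:
  assumes S: "field_graph S" and m: "relative_minpoly S y m m'" and "poly m' y' = 0"
  shows "field_graph (adjoin S y y')"
  unfolding field_graph_def
proof (intro conjI allI impI ring_graph_adjoin field_graphD(1)[OF S])
  have zero: "poly q' y' = 0" if "poly_pair S q q'" "poly q y = 0" for q q'
  proof -
    have "m' dvd q'" using m that by (auto simp: relative_minpoly_def[OF S])
    then show ?thesis using assms(3) by (auto elim!: dvdE)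
  qed
  fix x x' assume "(x, x') \<in> adjoin S y y'"
  then obtain q q' where q: "poly_pair S q q'" "x = poly q y" "x' = poly q' y'"
    by (auto simp: adjoin_def)
  show "x = 0 \<longleftrightarrow> x' = 0"
  proof
    assume "x = 0"
    then show "x' = 0" using zero q by simp
  next
    assume "x' = 0"
    let ?p = "H (minpoly h x)"
    have "poly (pcompose ?p q') y' = 0"
      by (rule zero[OF poly_pair_pcompose_H[OF field_graphD(1)[OF S] q(1)]])
        (simp add: poly_pcompose flip: q(2))
    then have "coeff (minpoly h x) 0 = 0"
      using \<open>x' = 0\<close> q(3) by (simp add: poly_pcompose poly_0_coeff_0)
    then show "x = 0" using minpoly_coeff_0 by blast
  qed
qed

end

section \<open>Extending isometric partial isomorphisms\<close>

lemma nmult_inj: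
  fixes g g' :: "'g::linordered_ab_group_add"
  shows "0 < n \<Longrightarrow> nmult n g = nmult n g' \<longleftrightarrow> g = g'"
  using nmult_strict_mono[of g g' n] nmult_strict_mono[of g' g n] by (cases g g' rule: linorder_cases) auto

text \<open>Two different affine functions of \<open>n\<close> agree at most once: two coincidences
  would force equal slopes and then equal constants.\<close>

lemma finite_nmult_coincidences:
  fixes \<alpha> \<alpha>' \<beta> \<beta>' :: "'g::linordered_ab_group_add"
  assumes "\<alpha> \<noteq> \<alpha>' \<or> \<beta> \<noteq> \<beta>'"
  shows "finite {n. nmult n \<alpha> + \<beta> = nmult n \<alpha>' + \<beta>'}" (is "finite ?A")
proof -
  have no_less: False if mn: "m \<in> ?A" "n \<in> ?A" "m < n" for m n
  proof -
    have split: "nmult n \<gamma> = nmult (n - m) \<gamma> + nmult m \<gamma>" for \<gamma> :: 'g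
      using nmult_add[of "n - m" m \<gamma>] mn(3) by simp
    have m: "nmult m \<alpha> + \<beta> = nmult m \<alpha>' + \<beta>'" and "nmult n \<alpha> + \<beta> = nmult n \<alpha>' + \<beta>'"
      using mn by simp_all
    then have "nmult (n - m) \<alpha> + (nmult m \<alpha> + \<beta>) = nmult (n - m) \<alpha>' + (nmult m \<alpha>' + \<beta>')"
      unfolding split[of \<alpha>] split[of \<alpha>'] add.assoc by argo
    then have "nmult (n - m) \<alpha> = nmult (n - m) \<alpha>'"
      unfolding m by simp
    then have "\<alpha> = \<alpha>'" using nmult_inj[of "n - m" \<alpha> \<alpha>'] mn(3) by simp
    then show False using m assms by simp
  qed
  show ?thesis
  proof (cases "?A = {}")
    case False
    then obtain m where "m \<in> ?A" by blast
    then have "?A \<subseteq> {m}"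
      using no_less[of m] no_less[of _ m] nat_neq_iff by blast
    then show ?thesis using finite_subset by blast
  qed simp
qed

locale valued_closure = alg_closure h + valued_alg_closed v
  for h :: "'k::field \<Rightarrow> 'l::alg_closed_field"
    and v :: "'l \<Rightarrow> 'g::linordered_ab_group_add with_inf"
begin

definition isometric_graph :: "('l \<times> 'l) set \<Rightarrow> bool" where
  "isometric_graph S \<longleftrightarrow> ring_graph S \<and> (\<forall>x x'. (x, x') \<in> S \<longrightarrow> v x = v x')"

text \<open>Only zero has the value \<open>Infty\<close>, so preserving \<open>v\<close> already
  includes the condition on zeros.\<close>

lemma isometric_graphD:
  assumes "isometric_graph S"
  shows "ring_graph S" "field_graph S" "(x, x') \<in> S \<Longrightarrow> v x = v x'"
proof -
  show "ring_graph S" and v: "(x, x') \<in> S \<Longrightarrow> v x = v x'" for x x'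
    using assms by (auto simp: isometric_graph_def)
  then show "field_graph S"
    unfolding field_graph_def by (metis eq_Infty_iff)
qed

text \<open>Multiplying a new pair of polynomials by a power of the old one preserves all differences of
  values except for finitely many exponents.\<close>

lemma common_witness:
  assumes S: "isometric_graph S" and m: "relative_minpoly S b m m'"
    and bad: "\<And>b'. poly m' b' = 0 \<Longrightarrow> \<exists>q q'. poly_pair S q q' \<and> v (poly q b) \<noteq> v (poly q' b')"
    and A: "finite A" "A \<subseteq> {b'. poly m' b' = 0}"
  shows "\<exists>p p'. poly_pair S p p' \<and> poly p b \<noteq> 0 \<and> (\<forall>b'\<in>A. v (poly p b) \<noteq> v (poly p' b'))"
  using A
proof (induction A)
  case empty
  show ?case using poly_pair_1[OF isometric_graphD(1)[OF S]] by (intro exI[of _ 1]) simp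
next
  case (insert b' A)
  note rg = isometric_graphD(1)[OF S]
  \<comment> \<open>Each root \<open>c'\<close> of \<open>m'\<close> gives a partial isomorphism
    \<open>b \<mapsto> c'\<close>, so the values at \<open>b\<close> and at \<open>c'\<close> are
    finite simultaneously.\<close>
  have zero_iff: "poly q b = 0 \<longleftrightarrow> poly q' c' = 0" if "poly_pair S q q'" "poly m' c' = 0" for q q' c'
    using field_graphD(2)[OF field_graph_adjoin[OF isometric_graphD(2)[OF S] m that(2)]]
      adjoinI[OF that(1)] by blast
  obtain p p' where p: "poly_pair S p p'" "poly p b \<noteq> 0" "\<And>c'. c' \<in> A \<Longrightarrow> v (poly p b) \<noteq> v (poly p' c')"
    using insert by auto
  have root: "poly m' b' = 0" using insert.prems by simp
  obtain q q' where q: "poly_pair S q q'" "v (poly q b) \<noteq> v (poly q' b')"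
    using bad[OF root] by blast
  have "poly q b \<noteq> 0"
    using zero_iff[OF q(1) root] q(2) by (metis zero)
  \<comment> \<open>These are the exponents for which the combined pair fails to distinguish
    \<open>b\<close> from \<open>c'\<close>.\<close>
  let ?C = "\<lambda>c'. {n. v (poly (p ^ n * q) b) = v (poly (p' ^ n * q') c')}"
  have "finite (?C c')" if "c' \<in> insert b' A" for c'
  proof -
    have "poly m' c' = 0" using that insert.prems by auto
    then have "poly p' c' \<noteq> 0" "poly q' c' \<noteq> 0"
      using zero_iff[OF p(1)] zero_iff[OF q(1)] p(2) \<open>poly q b \<noteq> 0\<close> by simp_all
    with p(2) \<open>poly q b \<noteq> 0\<close> obtain \<alpha> \<alpha>' \<beta> \<beta>' where
      eq: "v (poly p b) = Val \<alpha>" "v (poly p' c') = Val \<alpha>'" "v (poly q b) = Val \<beta>" "v (poly q' c') = Val \<beta>'"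
      by (metis eq_Infty_iff with_inf.exhaust)
    have "?C c' = {n. nmult n \<alpha> + \<beta> = nmult n \<alpha>' + \<beta>'}"
      by (simp add: mult eq v_power)
    moreover have "\<alpha> \<noteq> \<alpha>' \<or> \<beta> \<noteq> \<beta>'"
      using that p(3) q(2) eq by force
    ultimately show ?thesis using finite_nmult_coincidences by simp
  qed
  then have "finite (\<Union>c'\<in>insert b' A. ?C c')"
    using insert.hyps by blast
  then obtain n where n: "n \<notin> (\<Union>c'\<in>insert b' A. ?C c')"
    using ex_new_if_finite infinite_UNIV_nat by blast
  have "poly_pair S (p ^ n * q) (p' ^ n * q')"
    by (intro poly_pair_mult[OF rg] poly_pair_power[OF rg] p q)
  moreover have "poly (p ^ n * q) b \<noteq> 0" using p \<open>poly q b \<noteq> 0\<close> by simp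
  ultimately show ?case using n by blast
qed

text \<open>If every candidate failed, one pair \<open>p\<close>, \<open>p'\<close> would
  distinguish \<open>b\<close> from all roots of \<open>m'\<close>. Extending \<open>S\<close> first
  to \<open>y = p(b)\<close>, with an image \<open>y'\<close> of the same value, yields a root
  \<open>b'\<close> of \<open>m'\<close> with \<open>p'(b') = y'\<close>, against the choice of
  \<open>p\<close>.\<close>

lemma isometric_extension_exists:
  assumes S: "isometric_graph S"
  shows "\<exists>b'. \<forall>q q'. poly_pair S q q' \<longrightarrow> v (poly q b) = v (poly q' b')"
proof (rule ccontr)
  assume "\<not> ?thesis"
  then have bad: "\<exists>q q'. poly_pair S q q' \<and> v (poly q b) \<noteq> v (poly q' b')" for b'
    by blast
  note rg = isometric_graphD(1)[OF S] and fg = isometric_graphD(2)[OF S]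
  obtain m m' where m: "relative_minpoly S b m m'"
    using relative_minpoly_exists[OF fg] by blast
  then have mm: "poly_pair S m m'" "m \<noteq> 0" "poly m b = 0"
    by (auto simp: relative_minpoly_def[OF fg])
  then have "m' \<noteq> 0" using poly_pair_eq_0_iff[OF fg] by blast
  then obtain p p' where p: "poly_pair S p p'"
    and diff: "\<And>b'. poly m' b' = 0 \<Longrightarrow> v (poly p b) \<noteq> v (poly p' b')"
    using common_witness[OF S m bad, of "{b'. poly m' b' = 0}"] poly_roots_finite by blast
  define y where "y = poly p b"
  obtain n n' where n: "relative_minpoly S y n n'"
    using relative_minpoly_exists[OF fg] by blast
  then have nn: "poly_pair S n n'" "n \<noteq> 0" "poly n y = 0"
    by (auto simp: relative_minpoly_def[OF fg])
  \<comment> \<open>\<open>S\<close> preserves values, so \<open>root_of_equal_value\<close> applies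
    to \<open>n\<close> and its image \<open>n'\<close>.\<close>
  have "v (coeff n k) = v (coeff n' k)" for k
    using nn(1) isometric_graphD(3)[OF S] by (auto simp: poly_pair_def)
  then obtain y' where y': "poly n' y' = 0" "v y' = v y"
    using root_of_equal_value nn(2,3) by metis
  let ?T = "adjoin S y y'"
  have T: "field_graph ?T"
    by (rule field_graph_adjoin[OF fg n y'(1)])
  note rgT = field_graphD(1)[OF T]
  have "poly_pair ?T m m'"
    using poly_pair_mono[OF adjoin_superset[OF rg] mm(1)] .
  moreover have "poly_pair ?T (p - [:y:]) (p' - [:y':])"
    using poly_pair_mono[OF adjoin_superset[OF rg] p]
    by (intro poly_pair_diff[OF rgT] poly_pair_const[OF rgT] adjoin_generator[OF rg])
  moreover have "poly (p - [:y:]) b = 0" by (simp add: y_def)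
  \<comment> \<open>\<open>b\<close> is a common root of \<open>m\<close> and \<open>p - y\<close>,
    both with coefficients in the domain of the extended graph.\<close>
  ultimately obtain b' where "poly m' b' = 0" "poly (p' - [:y':]) b' = 0"
    using poly_pair_common_root[OF T] mm(3) by blast
  then show False using diff[of b'] y' by (simp add: y_def)
qed

lemma isometric_graph_adjoin:
  assumes S: "isometric_graph S" and "\<And>q q'. poly_pair S q q' \<Longrightarrow> v (poly q b) = v (poly q' b')"
  shows "isometric_graph (adjoin S b b')"
  using assms ring_graph_adjoin[OF isometric_graphD(1)[OF S]]
  unfolding isometric_graph_def by (auto simp: adjoin_def)

lemma isometric_graph_Union:
  assumes "subset.chain (Collect isometric_graph) C" "C \<noteq> {}"
  shows "isometric_graph (\<Union>C)"
  unfolding isometric_graph_def ring_graph_def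
proof (intro conjI allI impI)
  have iso: "isometric_graph S" if "S \<in> C" for S
    using assms(1) that by (auto simp: subset.chain_def)
  show "(h k, h k) \<in> \<Union>C" for k
    using assms(2) iso ring_graph_h isometric_graphD(1) by blast
  show "v x = v x'" if "(x, x') \<in> \<Union>C" for x x'
    using that iso isometric_graphD(3) by blast
  fix x x' y y' assume "(x, x') \<in> \<Union>C" "(y, y') \<in> \<Union>C"
  then obtain S T where "S \<in> C" "T \<in> C" "(x, x') \<in> S" "(y, y') \<in> T" by blast
  then obtain U where U: "U \<in> C" "(x, x') \<in> U" "(y, y') \<in> U"
    using assms(1) unfolding subset_chain_def by blast
  then have "ring_graph U" using iso isometric_graphD(1) by blast
  then show "(x + y, x' + y') \<in> \<Union>C" "(x * y, x' * y') \<in> \<Union>C"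
    using U ring_graph_add ring_graph_mult by blast+
qed

theorem isometric_graph_extends_to_automorphism:
  assumes S0: "isometric_graph S0"
  obtains \<sigma> where "\<sigma> \<in> decomposition_group h v" "\<And>x x'. (x, x') \<in> S0 \<Longrightarrow> \<sigma> x = x'"
proof -
  have "\<exists>M\<in>{S. isometric_graph S \<and> S0 \<subseteq> S}. \<forall>X\<in>{S. isometric_graph S \<and> S0 \<subseteq> S}. M \<subseteq> X \<longrightarrow> X = M"
  proof (rule subset_Zorn_nonempty)
    fix C assume C: "C \<noteq> {}" "subset.chain {S. isometric_graph S \<and> S0 \<subseteq> S} C"
    then have "subset.chain (Collect isometric_graph) C" "\<And>S. S \<in> C \<Longrightarrow> S0 \<subseteq> S"
      by (auto simp: subset_chain_def)
    then show "\<Union>C \<in> {S. isometric_graph S \<and> S0 \<subseteq> S}"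
      using isometric_graph_Union C(1) by blast
  qed (use S0 in auto)
  then obtain M where M: "isometric_graph M" "S0 \<subseteq> M"
    and max: "\<And>X. isometric_graph X \<Longrightarrow> M \<subseteq> X \<Longrightarrow> X = M"
    by (auto; metis order_trans)
  note rg = isometric_graphD(1)[OF M(1)] and fg = isometric_graphD(2)[OF M(1)]
  \<comment> \<open>Adjoining any \<open>b\<close> to a maximal graph adds nothing, so
    \<open>b\<close> was already in the domain.\<close>
  have total: "\<exists>b'. (b, b') \<in> M" for b
  proof -
    obtain b' where b': "\<And>q q'. poly_pair M q q' \<Longrightarrow> v (poly q b) = v (poly q' b')"
      using isometric_extension_exists[OF M(1)] by blast
    then have "adjoin M b b' = M"
      using max isometric_graph_adjoin[OF M(1)] adjoin_superset[OF rg] by blast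
    then show ?thesis using adjoin_generator[OF rg, of b b'] by auto
  qed
  have unique: "x' = y'" if "(x, x') \<in> M" "(x, y') \<in> M" for x x' y'
    using field_graphD(2)[OF fg ring_graph_diff[OF rg that]] by simp
  define \<sigma> where "\<sigma> x = (SOME x'. (x, x') \<in> M)" for x
  have \<sigma>: "(x, \<sigma> x) \<in> M" for x
    unfolding \<sigma>_def using total by (rule someI_ex)
  have \<sigma>I: "\<sigma> x = x'" if "(x, x') \<in> M" for x x'
    using unique[OF \<sigma> that] .
  have add: "\<sigma> (x + y) = \<sigma> x + \<sigma> y" and mul: "\<sigma> (x * y) = \<sigma> x * \<sigma> y" for x y
    by (intro \<sigma>I ring_graph_add[OF rg] ring_graph_mult[OF rg] \<sigma>)+
  have inj: "inj \<sigma>"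
  proof (rule injI)
    fix x y assume "\<sigma> x = \<sigma> y"
    then show "x = y" using field_graphD(2)[OF fg ring_graph_diff[OF rg \<sigma> \<sigma>, of x y]] by simp
  qed
  have "surj \<sigma>"
    unfolding surj_def
  proof
    fix y
    \<comment> \<open>\<open>\<sigma>\<close> maps the finite set of conjugates of \<open>y\<close>
      injectively into itself, hence onto itself.\<close>
    let ?Z = "{x. poly (H (minpoly h y)) x = 0}"
    have "finite ?Z" by (intro poly_roots_finite) simp
    moreover have "\<sigma> ` ?Z \<subseteq> ?Z"
      using field_graph_algebraic_root[OF fg \<sigma>] by auto
    ultimately have "\<sigma> ` ?Z = ?Z"
      using inj by (intro endo_inj_surj) (auto intro: inj_on_subset)
    then have "y \<in> \<sigma> ` ?Z" by simp
    then show "\<exists>x. y = \<sigma> x" by blast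
  qed
  moreover have "\<sigma> (h k) = h k" for k
    by (intro \<sigma>I ring_graph_h[OF rg])
  moreover have "v \<circ> \<sigma> = v"
    using isometric_graphD(3)[OF M(1) \<sigma>] by (simp add: fun_eq_iff)
  ultimately have "\<sigma> \<in> decomposition_group h v"
    using add mul inj by (simp add: decomposition_group_def bij_def)
  then show ?thesis using that \<sigma>I M(2) by blast
qed

end

section \<open>Valuations of the polynomial ring over the base field\<close>

lemma pcompose_conv_sum:
  "pcompose p q = (\<Sum>i\<le>degree p. [:coeff p i:] * q ^ i)" for p q :: "'a::field poly"
  by (simp add: pcompose_altdef poly_altdef coeff_map_poly degree_map_poly)

context valued_closure
begin

abbreviation "rv a \<delta> \<equiv> restrict_val h (mv a \<delta>)"

lemma valuation_rv: "valuation (rv a \<delta>)"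
  using valuation_mv[of a \<delta>] by (simp add: valuation_def restrict_val_def H_add H_mult)

lemma rv_in_valuations_over: "rv a \<delta> \<in> valuations_over h v"
  using valuation_rv by (simp add: valuations_over_def restrict_val_def)

lemma rv_center: "c \<in> vcball v a \<delta> \<Longrightarrow> rv a \<delta> = rv c \<delta>"
  using mv_center[of \<delta> a c] by (simp add: vcball_def minus_commute restrict_val_def fun_eq_iff)

lemma rv_less_iff:
  "\<delta> < \<epsilon> \<Longrightarrow> rv a \<delta> f < rv a \<epsilon> f \<longleftrightarrow> f \<noteq> 0 \<and> (\<exists>r\<in>voball v a \<delta>. poly (H f) r = 0)"
  by (simp add: restrict_val_def mv_less_iff)

section \<open>Roots of polynomials whose value increases\<close>

text \<open>\<open>g\<close> and \<open>\<alpha>\<close> agree up to larger values; splitting the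
  difference of products carries this over to powers.\<close>

lemma mv_power_diff:
  assumes "mv a \<delta> g = Val \<gamma>" "v \<alpha> = Val \<gamma>" "Val \<gamma> < mv a \<delta> (g - [:\<alpha>:])"
  shows "Val (nmult i \<gamma>) < mv a \<delta> (g ^ i - [:\<alpha>:] ^ i)"
proof (induction i)
  case (Suc i)
  have "g ^ Suc i - [:\<alpha>:] ^ Suc i = g * (g ^ i - [:\<alpha>:] ^ i) + (g - [:\<alpha>:]) * [:\<alpha>:] ^ i"
    by (simp add: algebra_simps)
  moreover have "Val (nmult (Suc i) \<gamma>) < mv a \<delta> (g * (g ^ i - [:\<alpha>:] ^ i))"
    using with_inf_add_le_less_mono[OF _ Suc, of "Val \<gamma>" "Val \<gamma>"] by (simp add: mv_mult assms(1))
  moreover have "mv a \<delta> ([:\<alpha>:] ^ i) = Val (nmult i \<gamma>)"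
    using v_power[OF assms(2)] by (simp add: poly_const_pow)
  then have "Val (nmult (Suc i) \<gamma>) < mv a \<delta> ((g - [:\<alpha>:]) * [:\<alpha>:] ^ i)"
    using with_inf_add_less_le_mono[OF assms(3), of "Val (nmult i \<gamma>)" "Val (nmult i \<gamma>)"]
    by (simp add: mv_mult)
  ultimately show ?case using mv.add_less by simp
qed simp

text \<open>\<open>Q\<close> is obtained from the minimal polynomial of \<open>\<alpha>\<close> by cutting off the terms below the first one
  of minimal value and dividing by a power of the variable.\<close>

lemma exceptional_polynomial:
  assumes "v \<alpha> = Val \<gamma>"
  obtains Q where "coeff Q 0 \<noteq> 0" "v (h (coeff Q 0)) < v (poly (H Q) \<alpha>)"
    "\<And>i. v (h (coeff Q 0)) \<le> v (h (coeff Q i)) + Val (nmult i \<gamma>)"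
proof -
  define P where "P = minpoly h \<alpha>"
  let ?t = "tm 0 \<gamma> (H P)"
  have t: "?t i = v (h (coeff P i)) + Val (nmult i \<gamma>)" for i
    by (simp add: monomial_term_def)
  \<comment> \<open>Taking the first index of minimal value makes all terms that are cut off
    strictly larger.\<close>
  define s where "s = (LEAST k. ?t k = mv 0 \<gamma> (H P))"
  have s: "?t s = mv 0 \<gamma> (H P)"
    unfolding s_def by (rule LeastI_ex) (metis mv_attained)
  then have s_le: "?t s \<le> ?t i" for i
    using mv_le_tm by simp
  have s_less: "?t s < ?t i" if "i < s" for i
    using not_less_Least[OF that[unfolded s_def]] s_le[of i] s by (auto simp: order.strict_iff_order)
  define Q where "Q = poly_shift s P"
  have "?t s \<noteq> Infty"
    using s by (simp add: P_def)
  then have nz: "coeff Q 0 \<noteq> 0"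
    by (auto simp: t Q_def coeff_poly_shift)
  then obtain e where e: "v (h (coeff Q 0)) = Val e"
    by (metis eq_Infty_iff h_eq_0_iff with_inf.exhaust)
  have ts: "?t s = Val e + Val (nmult s \<gamma>)"
    using e by (simp add: t Q_def coeff_poly_shift)
  have "v (h (coeff Q 0)) \<le> v (h (coeff Q i)) + Val (nmult i \<gamma>)" for i
  proof -
    have "Val e + Val (nmult s \<gamma>) \<le> v (h (coeff Q i)) + Val (nmult i \<gamma> + nmult s \<gamma>)"
      using s_le[of "i + s"] unfolding ts by (simp add: t Q_def coeff_poly_shift nmult_add)
    then show ?thesis
      by (cases "v (h (coeff Q i))") (simp_all add: e flip: add.assoc)
  qed
  moreover have "v (h (coeff Q 0)) < v (poly (H Q) \<alpha>)"
  proof -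
    define C where "C = poly_cutoff s P"
    \<comment> \<open>Since \<open>P(\<alpha>) = 0\<close>, the value of
      \<open>\<alpha> ^ s * Q(\<alpha>)\<close> is that of the cut-off part, which exceeds the
      minimal term.\<close>
    have "P = monom 1 s * Q + C"
      by (rule poly_eqI) (simp add: coeff_monom_mult coeff_poly_cutoff C_def Q_def coeff_poly_shift)
    from arg_cong[OF this, of "\<lambda>p. poly (H p) \<alpha>"] have "poly (H P) \<alpha> = \<alpha> ^ s * poly (H Q) \<alpha> + poly (H C) \<alpha>"
      by (simp add: H_add H_mult map_poly_monom poly_monom)
    then have "\<alpha> ^ s * poly (H Q) \<alpha> = - poly (H C) \<alpha>"
      by (simp add: P_def eq_neg_iff_add_eq_0)
    moreover have "?t s < v (poly (H C) \<alpha>)"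
      unfolding poly_altdef
    proof (rule sum_less)
      fix i
      show "?t s < v (coeff (H C) i * \<alpha> ^ i)"
        using s_less[of i] \<open>?t s \<noteq> Infty\<close>
        by (cases "i < s") (simp_all add: mult v_power[OF assms] coeff_poly_cutoff C_def t)
    qed fact
    ultimately have "?t s < Val (nmult s \<gamma>) + v (poly (H Q) \<alpha>)"
      by (metis minus mult v_power[OF assms])
    then show ?thesis
      by (cases "v (poly (H Q) \<alpha>)") (simp_all add: ts e)
  qed
  ultimately show ?thesis using that nz by blast
qed

text \<open>Without such a root, \<open>f\<close> behaves like the constant \<open>\<alpha>\<close>
  under \<open>rv a \<delta>\<close>. Then \<open>Q\<close> evaluated at \<open>f\<close> has a
  value above \<open>v (h (coeff Q 0))\<close> under \<open>rv a \<delta>\<close>, but exactly this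
  value under \<open>\<eta>\<close>, contradicting \<open>le\<close>.\<close>

lemma root_in_vcball:
  assumes \<eta>: "\<eta> \<in> valuations_over h v" and le: "\<And>f. rv a \<delta> f \<le> \<eta> f"
    and less: "rv a \<delta> f < \<eta> f"
  shows "\<exists>r\<in>vcball v a \<delta>. poly (H f) r = 0"
proof (rule ccontr)
  assume none: "\<not> ?thesis"
  interpret \<eta>: valued \<eta> using \<eta> by unfold_locales (simp add: valuations_over_def)
  have \<eta>_const: "\<eta> [:c:] = v (h c)" for c
    using \<eta> by (simp add: valuations_over_def)
  define g where "g = H f"
  define \<alpha> where "\<alpha> = poly g a"
  have "f \<noteq> 0" using less by (auto simp: restrict_val_def)
  then have "g \<noteq> 0" by (simp add: g_def)
  have no_root: "poly g r \<noteq> 0" if "r \<in> vcball v a \<delta>" for r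
    using none that by (auto simp: g_def)
  have "\<alpha> \<noteq> 0" using no_root[of a] by (simp add: \<alpha>_def vcball_def)
  then obtain \<gamma> where \<gamma>: "v \<alpha> = Val \<gamma>" by (metis eq_Infty_iff with_inf.exhaust)
  have diff: "Val \<gamma> < mv a \<delta> (g - [:\<alpha>:])"
    using mv_diff_const[OF \<open>g \<noteq> 0\<close>, of a \<delta>] no_root by (simp add: \<gamma> flip: \<alpha>_def)
  have g: "mv a \<delta> g = Val \<gamma>"
    using mv_eq_v_poly[of a \<delta> g] no_root by (auto simp: \<gamma> vcball_def voball_def less_imp_le simp flip: \<alpha>_def)
  obtain Q where Q: "coeff Q 0 \<noteq> 0" "v (h (coeff Q 0)) < v (poly (H Q) \<alpha>)"
    and Q_le: "\<And>i. v (h (coeff Q 0)) \<le> v (h (coeff Q i)) + Val (nmult i \<gamma>)"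
    using exceptional_polynomial[OF \<gamma>] by blast
  let ?e = "v (h (coeff Q 0))" and ?F = "pcompose Q f"
  have e: "?e \<noteq> Infty" using Q(1) by simp
  have larger: "?e < v (h (coeff Q i)) + z" if "Val (nmult i \<gamma>) < z" for i z
  proof (cases "coeff Q i = 0")
    case False
    have "v (h (coeff Q i)) + Val (nmult i \<gamma>) < v (h (coeff Q i)) + z"
      using that False by simp
    then show ?thesis using Q_le[of i] by (rule le_less_trans[rotated])
  qed (use Q(1) in simp)
  \<comment> \<open>\<open>\<eta> f\<close> exceeds \<open>Val \<gamma>\<close>, so under
    \<open>\<eta>\<close> every other term of \<open>?F\<close> lies strictly above the constant
    one.\<close>
  have "\<eta> ?F = \<eta> ([:coeff Q 0:] * f ^ 0)"
    unfolding pcompose_conv_sum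
  proof (rule \<eta>.sum_eq)
    fix i :: nat assume "i \<noteq> 0"
    obtain \<gamma>' where \<gamma>': "\<eta> f = Val \<gamma>'"
      using \<open>f \<noteq> 0\<close> by (metis \<eta>.eq_Infty_iff with_inf.exhaust)
    have "\<eta> (f ^ j) = Val (nmult j \<gamma>')" for j
      by (induction j) (simp_all add: \<eta>.mult \<gamma>')
    moreover have "\<gamma> < \<gamma>'"
      using less \<gamma>' g by (simp add: restrict_val_def flip: g_def)
    ultimately have "Val (nmult i \<gamma>) < \<eta> (f ^ i)"
      using \<open>i \<noteq> 0\<close> by (simp add: nmult_strict_mono)
    then show "\<eta> ([:coeff Q 0:] * f ^ 0) < \<eta> ([:coeff Q i:] * f ^ i)"
      using larger by (simp only: \<eta>.mult \<eta>_const) simp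
  qed auto
  then have "\<eta> ?F = ?e"
    by (simp add: \<eta>_const)
  \<comment> \<open>Replacing \<open>f\<close> by \<open>\<alpha>\<close> produces
    \<open>Q(\<alpha>)\<close>, already of larger value, and by \<open>mv_power_diff\<close> the
    error terms are larger as well.\<close>
  moreover have "?e < rv a \<delta> ?F"
  proof -
    have H_F: "H ?F = (\<Sum>i\<le>degree Q. [:h (coeff Q i):] * g ^ i)"
      unfolding H_pcompose pcompose_conv_sum[of "H Q"] degree_H coeff_H g_def ..
    have "[:poly (H Q) \<alpha>:] = (\<Sum>i\<le>degree Q. [:h (coeff Q i):] * [:\<alpha>:] ^ i)"
      using pcompose_conv_sum[of "H Q" "[:\<alpha>:]"] by (simp only: pcompose_pCons_0 degree_H coeff_H)
    then have "H ?F = [:poly (H Q) \<alpha>:] + (\<Sum>i\<le>degree Q. [:h (coeff Q i):] * (g ^ i - [:\<alpha>:] ^ i))"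
      by (simp only: H_F right_diff_distrib sum_subtractf) simp
    moreover have "?e < mv a \<delta> (\<Sum>i\<le>degree Q. [:h (coeff Q i):] * (g ^ i - [:\<alpha>:] ^ i))"
    proof (rule mv.sum_less[OF e])
      fix i
      show "?e < mv a \<delta> ([:h (coeff Q i):] * (g ^ i - [:\<alpha>:] ^ i))"
        unfolding mv_mult mv_const by (rule larger[OF mv_power_diff[OF g \<gamma> diff]])
    qed
    moreover have "?e < mv a \<delta> [:poly (H Q) \<alpha>:]" using Q(2) by simp
    ultimately show ?thesis
      unfolding restrict_val_def using mv.add_less by presburger
  qed
  ultimately show False using le[of ?F] by simp
qed

subsection \<open>Tangent directions\<close>

context
  fixes \<mu> \<eta> :: "'k poly \<Rightarrow> 'g with_inf"
  assumes \<mu>: "\<mu> \<in> valuations_over h v" and \<eta>: "\<eta> \<in> valuations_over h v"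
    and le: "\<And>f. \<mu> f \<le> \<eta> f"
begin

interpretation \<mu>: valued \<mu> using \<mu> by unfold_locales (simp add: valuations_over_def)
interpretation \<eta>: valued \<eta> using \<eta> by unfold_locales (simp add: valuations_over_def)

text \<open>Nonzero constants have the same finite value under both valuations, so division by the
  leading coefficient preserves strictness.\<close>

lemma less_normalized:
  assumes "\<mu> f < \<eta> f"
  obtains g where "lead_coeff g = 1" "degree g = degree f" "\<mu> g < \<eta> g"
proof
  have "f \<noteq> 0" using assms by auto
  let ?c = "inverse (lead_coeff f)"
  have smult: "smult ?c f = [:?c:] * f" by simp
  have const: "\<mu> [:?c:] = \<eta> [:?c:]" using \<mu> \<eta> by (simp add: valuations_over_def)
  show "\<mu> (smult ?c f) < \<eta> (smult ?c f)"
    unfolding smult \<mu>.mult \<eta>.mult const using assms \<open>f \<noteq> 0\<close> by simp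
  show "lead_coeff (smult ?c f) = 1" "degree (smult ?c f) = degree f"
    using \<open>f \<noteq> 0\<close> by auto
qed

lemma tangent_direction_nonempty:
  assumes "\<mu> f < \<eta> f"
  shows "tangent_direction \<mu> \<eta> \<noteq> {}"
proof -
  obtain g where "lead_coeff g = 1 \<and> \<mu> g < \<eta> g"
    using less_normalized[OF assms] by metis
  then obtain \<phi> where "lead_coeff \<phi> = 1 \<and> \<mu> \<phi> < \<eta> \<phi>"
    "\<And>\<psi>. lead_coeff \<psi> = 1 \<and> \<mu> \<psi> < \<eta> \<psi> \<Longrightarrow> degree \<phi> \<le> degree \<psi>"
    using ex_has_least_nat[of "\<lambda>g. lead_coeff g = 1 \<and> \<mu> g < \<eta> g" g degree] by metis
  then have "\<phi> \<in> tangent_direction \<mu> \<eta>" by (simp add: tangent_direction_def)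
  then show ?thesis by blast
qed

context
  fixes \<phi> assumes \<phi>: "\<phi> \<in> tangent_direction \<mu> \<eta>"
begin

lemma tangent_less: "\<mu> \<phi> < \<eta> \<phi>"
  using \<phi> by (simp add: tangent_direction_def)

lemma tangent_nonzero: "\<phi> \<noteq> 0"
  using tangent_less by auto

lemma tangent_minimal: "lead_coeff \<psi> = 1 \<and> \<mu> \<psi> < \<eta> \<psi> \<Longrightarrow> degree \<phi> \<le> degree \<psi>"
  using \<phi> unfolding tangent_direction_def by blast

lemma eq_below_tangent_degree:
  assumes "degree f < degree \<phi>"
  shows "\<mu> f = \<eta> f"
proof (rule ccontr)
  assume "\<mu> f \<noteq> \<eta> f"
  then have "\<mu> f < \<eta> f" using le[of f] by simp
  then obtain g where "lead_coeff g = 1 \<and> \<mu> g < \<eta> g" "degree g = degree f"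
    using less_normalized by metis
  then have "degree \<phi> \<le> degree f"
    using tangent_minimal[of g] by simp
  then show False using assms by simp
qed

lemma eq_mod_tangent: "\<mu> (f mod \<phi>) = \<eta> (f mod \<phi>)"
  using eq_below_tangent_degree[of "f mod \<phi>"] degree_mod_less[OF tangent_nonzero, of f] by auto

lemma less_tangent_multiple:
  assumes "q \<noteq> 0"
  shows "\<mu> (q * \<phi>) < \<eta> (q * \<phi>)"
  unfolding \<mu>.mult \<eta>.mult using assms tangent_less le
  by (intro with_inf_add_le_less_mono) simp_all

text \<open>Cancellation would need equal values of both parts under \<open>\<mu>\<close>. But
  \<open>\<eta>\<close> raises only the multiple of \<open>\<phi>\<close>, so then \<open>\<mu> f
  \<le> \<eta> f = \<eta> (f mod \<phi>) = \<mu> (f mod \<phi>)\<close>.\<close>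

lemma val_div_mod_tangent: "\<mu> f = min (\<mu> (f div \<phi> * \<phi>)) (\<mu> (f mod \<phi>))"
proof (cases "f div \<phi> = 0 \<or> \<mu> (f div \<phi> * \<phi>) \<noteq> \<mu> (f mod \<phi>)")
  case True
  have f: "f = f div \<phi> * \<phi> + f mod \<phi>" by simp
  show ?thesis
  proof (cases "f div \<phi> = 0")
    case True
    then show ?thesis using f by simp
  next
    case False
    then consider "\<mu> (f div \<phi> * \<phi>) < \<mu> (f mod \<phi>)" | "\<mu> (f mod \<phi>) < \<mu> (f div \<phi> * \<phi>)"
      using True by (meson linorder_neqE)
    then show ?thesis
    proof cases
      case 1
      then have "\<mu> (f div \<phi> * \<phi> + f mod \<phi>) = \<mu> (f div \<phi> * \<phi>)" by (rule \<mu>.add_eq)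
      then show ?thesis using 1 by simp
    next
      case 2
      then have "\<mu> (f mod \<phi> + f div \<phi> * \<phi>) = \<mu> (f mod \<phi>)" by (rule \<mu>.add_eq)
      then show ?thesis using 2 by (simp add: add.commute)
    qed
  qed
next
  case False
  then have eq: "\<mu> (f div \<phi> * \<phi>) = \<mu> (f mod \<phi>)" and "f div \<phi> \<noteq> 0" by auto
  then have "\<eta> (f mod \<phi>) < \<eta> (f div \<phi> * \<phi>)"
    using less_tangent_multiple eq_mod_tangent[of f] by metis
  then have "\<eta> (f mod \<phi> + f div \<phi> * \<phi>) = \<eta> (f mod \<phi>)" by (rule \<eta>.add_eq)
  then have "\<mu> f \<le> \<mu> (f mod \<phi>)"
    using le[of f] eq_mod_tangent[of f] by (simp add: add.commute)
  moreover have "min (\<mu> (f div \<phi> * \<phi>)) (\<mu> (f mod \<phi>)) \<le> \<mu> f"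
    using \<mu>.add_ge[of "f div \<phi> * \<phi>" "f mod \<phi>"] by simp
  ultimately show ?thesis using eq by simp
qed

text \<open>Only the multiple of \<open>\<phi>\<close> increases, so \<open>f\<close> increases
  unless the remainder attains the minimum. The right-hand side does not mention
  \<open>\<eta>\<close>: one member of a tangent direction decides which polynomials
  increase.\<close>

lemma less_iff_less_mod_tangent: "\<mu> f < \<eta> f \<longleftrightarrow> \<mu> f < \<mu> (f mod \<phi>)"
proof
  assume *: "\<mu> f < \<mu> (f mod \<phi>)"
  then have "\<mu> f = \<mu> (f div \<phi> * \<phi>)"
    using val_div_mod_tangent[of f] by (auto simp: min_def split: if_splits)
  moreover have "f div \<phi> \<noteq> 0"
    using * by (metis add_0 div_mult_mod_eq less_irrefl mult_zero_left)
  ultimately have "\<mu> f < \<eta> (f div \<phi> * \<phi>)" "\<mu> f < \<eta> (f mod \<phi>)"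
    using less_tangent_multiple * eq_mod_tangent[of f] by metis+
  then have "\<mu> f < \<eta> (f div \<phi> * \<phi> + f mod \<phi>)" by (rule \<eta>.add_less)
  then show "\<mu> f < \<eta> f" by simp
next
  assume *: "\<mu> f < \<eta> f"
  show "\<mu> f < \<mu> (f mod \<phi>)"
  proof (rule ccontr)
    assume "\<not> ?thesis"
    then have mod_le: "\<mu> (f mod \<phi>) \<le> \<mu> f" by simp
    also have "\<mu> f < Infty" using * by auto
    finally have finite: "f mod \<phi> \<noteq> 0" by auto
    have mod: "\<mu> f = \<mu> (f mod \<phi>)" "\<mu> (f mod \<phi>) \<le> \<mu> (f div \<phi> * \<phi>)"
      using val_div_mod_tangent[of f] mod_le by (auto simp: min_def split: if_splits)
    show False
    proof (cases "f div \<phi> = 0")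
      case True
      then have "f mod \<phi> = f" by (metis add_0 div_mult_mod_eq mult_zero_left)
      then show False using eq_mod_tangent[of f] * by simp
    next
      case False
      then have "\<eta> (f mod \<phi>) < \<eta> (f div \<phi> * \<phi>)"
        using less_tangent_multiple[OF False] mod(2) eq_mod_tangent[of f] by (metis le_less_trans)
      then have "\<eta> (f mod \<phi> + f div \<phi> * \<phi>) = \<eta> (f mod \<phi>)" by (rule \<eta>.add_eq)
      then show False using * mod(1) eq_mod_tangent[of f] by (simp add: add.commute)
    qed
  qed
qed

end

end

lemma tangent_direction_eqI:
  assumes "\<mu> \<in> valuations_over h v" "\<eta> \<in> valuations_over h v" "\<eta>' \<in> valuations_over h v"
    and "\<And>f. \<mu> f \<le> \<eta> f" "\<And>f. \<mu> f \<le> \<eta>' f"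
    and "\<phi> \<in> tangent_direction \<mu> \<eta>" "\<phi> \<in> tangent_direction \<mu> \<eta>'"
  shows "tangent_direction \<mu> \<eta> = tangent_direction \<mu> \<eta>'"
proof -
  have "\<mu> f < \<eta> f \<longleftrightarrow> \<mu> f < \<eta>' f" for f
    using less_iff_less_mod_tangent assms by metis
  then show ?thesis by (simp add: tangent_direction_def)
qed

end

section \<open>Key polynomials of open balls\<close>

context valued_closure
begin

lemma center_in_voball [simp]: "c \<in> voball v c \<delta>"
  by (simp add: voball_def)

lemma voball_center: "d \<in> voball v c \<delta> \<Longrightarrow> voball v d \<delta> = voball v c \<delta>"
proof -
  assume d: "d \<in> voball v c \<delta>"
  then have "Val \<delta> < v (d - c)" by (simp add: voball_def)
  then have "Val \<delta> < v (b - d) \<longleftrightarrow> Val \<delta> < v (b - c)" for b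
    using add_less[of "Val \<delta>" "b - d" "d - c"] diff_less[of "Val \<delta>" "b - c" "d - c"] by auto
  then show ?thesis by (auto simp: voball_def)
qed

lemma voball_subset_vcball: "c \<in> vcball v a \<delta> \<Longrightarrow> voball v c \<delta> \<subseteq> vcball v a \<delta>"
proof
  fix b assume "c \<in> vcball v a \<delta>" "b \<in> voball v c \<delta>"
  then show "b \<in> vcball v a \<delta>"
    using add_le[of "Val \<delta>" "b - c" "c - a"] by (auto simp: vcball_def voball_def less_imp_le)
qed

text \<open>This is \<open>KP\<close> of the theorem, indexed by a centre of the ball.\<close>

definition key_polys :: "'l \<Rightarrow> 'g \<Rightarrow> 'k poly set" where
  "key_polys c \<delta> = minpoly h ` Min_over h (voball v c \<delta>)"

lemma Min_over_iff: "c \<in> Min_over h S \<longleftrightarrow> c \<in> S \<and> (\<forall>d\<in>S. deg_over h c \<le> deg_over h d)"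
proof (cases "c \<in> S")
  case True
  have "deg_over h c = (LEAST n. n \<in> deg_over h ` S) \<longleftrightarrow> (\<forall>d\<in>S. deg_over h c \<le> deg_over h d)"
    using True by (auto intro!: Least_equality[symmetric] Least_le)
  then show ?thesis using True by (simp add: Min_over_def set_deg_over_def)
qed (simp add: Min_over_def)

lemma Min_over_nonempty:
  assumes "c \<in> S"
  shows "Min_over h S \<noteq> {}"
proof -
  obtain d where "d \<in> S" "\<And>b. b \<in> S \<Longrightarrow> deg_over h d \<le> deg_over h b"
    using ex_has_least_nat[of "\<lambda>b. b \<in> S" c "deg_over h"] assms by blast
  then have "d \<in> Min_over h S" by (simp add: Min_over_iff)
  then show ?thesis by blast
qed

text \<open>A nonzero polynomial increases exactly if it has a root in the open ball. A monic one of
  least degree must be the minimal polynomial of that root, which then has least degree in the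
  ball.\<close>

lemma tangent_direction_rv:
  assumes "\<delta> < \<epsilon>"
  shows "tangent_direction (rv c \<delta>) (rv c \<epsilon>) = key_polys c \<delta>"
proof -
  let ?B = "voball v c \<delta>"
  have less: "lead_coeff \<psi> = 1 \<and> rv c \<delta> \<psi> < rv c \<epsilon> \<psi> \<longleftrightarrow>
    lead_coeff \<psi> = 1 \<and> (\<exists>r\<in>?B. poly (H \<psi>) r = 0)" for \<psi>
    using rv_less_iff[OF assms] by auto
  show ?thesis
  proof (intro equalityI subsetI)
    fix \<phi> assume "\<phi> \<in> tangent_direction (rv c \<delta>) (rv c \<epsilon>)"
    then have monic: "lead_coeff \<phi> = 1" and root: "\<exists>r\<in>?B. poly (H \<phi>) r = 0"
      and min: "lead_coeff \<psi> = 1 \<and> (\<exists>r\<in>?B. poly (H \<psi>) r = 0) \<Longrightarrow> degree \<phi> \<le> degree \<psi>" for \<psi>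
      using less unfolding tangent_direction_def by blast+
    obtain r where r: "r \<in> ?B" "poly (H \<phi>) r = 0" using root by blast
    have min': "degree \<phi> \<le> degree (minpoly h d)" if "d \<in> ?B" for d
      using min[of "minpoly h d"] that minpoly_root[of d] minpoly_monic[of d] by blast
    have "minpoly h r = \<phi>"
    proof (rule minpoly_eqI[OF monic r(2)])
      fix q assume "q \<noteq> 0" "poly (H q) r = 0"
      then show "degree \<phi> \<le> degree q"
        using min'[OF r(1)] minpoly_minimal[of q r] by linarith
    qed
    moreover have "r \<in> Min_over h ?B"
      using r(1) min' by (simp add: Min_over_iff deg_over_def \<open>minpoly h r = \<phi>\<close>)
    ultimately show "\<phi> \<in> key_polys c \<delta>" unfolding key_polys_def by blast
  next
    fix \<phi> assume "\<phi> \<in> key_polys c \<delta>"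
    then obtain r where r: "r \<in> ?B" "\<phi> = minpoly h r"
      and min: "\<And>d. d \<in> ?B \<Longrightarrow> degree \<phi> \<le> degree (minpoly h d)"
      by (auto simp: key_polys_def Min_over_iff deg_over_def)
    have "degree \<phi> \<le> degree \<psi>" if "lead_coeff \<psi> = 1" "d \<in> ?B" "poly (H \<psi>) d = 0" for \<psi> d
    proof -
      have "\<psi> \<noteq> 0" using that(1) by auto
      then show ?thesis using minpoly_minimal[of \<psi> d] min[of d] that by linarith
    qed
    moreover have "lead_coeff \<phi> = 1" "poly (H \<phi>) r = 0"
      unfolding r(2) by (rule minpoly_monic minpoly_root)+
    ultimately show "\<phi> \<in> tangent_direction (rv c \<delta>) (rv c \<epsilon>)"
      unfolding tangent_direction_def using less r(1) by blast
  qed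
qed

lemma rv_mono: "\<delta> \<le> \<epsilon> \<Longrightarrow> rv c \<delta> f \<le> rv c \<epsilon> f"
  by (simp add: restrict_val_def mv_mono)

text \<open>A root \<open>r\<close> of a member \<open>\<phi>\<close> selects the ball. The work
  lies in showing that \<open>\<phi>\<close> has least degree also for the comparison valuation
  \<open>rv r \<epsilon>\<close>; then \<open>tangent_direction_eqI\<close> identifies both
  directions.\<close>

lemma tangent_direction_is_key_polys:
  assumes \<delta>: "\<delta> < \<epsilon>" and \<eta>: "\<eta> \<in> valuations_over h v"
    and le: "\<And>f. rv a \<delta> f \<le> \<eta> f" and neq: "rv a \<delta> \<noteq> \<eta>"
  shows "\<exists>r\<in>vcball v a \<delta>. tangent_direction (rv a \<delta>) \<eta> = key_polys r \<delta>"
proof -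
  let ?\<mu> = "rv a \<delta>"
  note \<mu> = rv_in_valuations_over[of a \<delta>]
  obtain f where "?\<mu> f \<noteq> \<eta> f" using neq by blast
  then have "?\<mu> f < \<eta> f" using le[of f] by simp
  then obtain \<phi> where \<phi>: "\<phi> \<in> tangent_direction ?\<mu> \<eta>"
    using tangent_direction_nonempty[OF \<mu> \<eta> le] by blast
  have less: "?\<mu> \<phi> < \<eta> \<phi>" by (rule tangent_less[OF \<mu> \<eta> le \<phi>])
  have monic: "lead_coeff \<phi> = 1" using \<phi> by (simp add: tangent_direction_def)
  obtain r where r: "r \<in> vcball v a \<delta>" "poly (H \<phi>) r = 0"
    using root_in_vcball[OF \<eta> le less] by blast
  define \<eta>' where "\<eta>' = rv r \<epsilon>"
  have \<mu>_r: "?\<mu> = rv r \<delta>" using rv_center[OF r(1)] .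
  have \<eta>': "\<eta>' \<in> valuations_over h v" unfolding \<eta>'_def by (rule rv_in_valuations_over)
  have le': "?\<mu> f \<le> \<eta>' f" for f
    unfolding \<mu>_r \<eta>'_def using \<delta> by (intro rv_mono) simp
  have less': "?\<mu> \<phi> < \<eta>' \<phi>"
    unfolding \<mu>_r \<eta>'_def rv_less_iff[OF \<delta>] using r(2) monic by force
  have "\<phi> \<in> tangent_direction ?\<mu> \<eta>'"
  proof (rule ccontr)
    assume not: "\<phi> \<notin> tangent_direction ?\<mu> \<eta>'"
    obtain \<psi> where \<psi>: "\<psi> \<in> tangent_direction ?\<mu> \<eta>'"
      using tangent_direction_nonempty[OF \<mu> \<eta>' le' less'] by blast
    have "\<not> degree \<phi> \<le> degree \<psi>"
    proof
      assume "degree \<phi> \<le> degree \<psi>"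
      then have "\<phi> \<in> tangent_direction ?\<mu> \<eta>'"
        using \<psi> monic less' unfolding tangent_direction_def by fastforce
      then show False using not by blast
    qed
    then have deg: "degree \<psi> < degree \<phi>" by simp
    interpret \<eta>: valued \<eta> using \<eta> by unfold_locales (simp add: valuations_over_def)
    interpret \<mu>: valued ?\<mu> by unfold_locales (rule valuation_rv)
    let ?q = "\<phi> div \<psi>"
    have mod_less: "?\<mu> \<phi> < ?\<mu> (\<phi> mod \<psi>)"
      using less' less_iff_less_mod_tangent[OF \<mu> \<eta>' le' \<psi>] by blast
    then have q_val: "?\<mu> \<phi> = ?\<mu> (?q * \<psi>)"
      using val_div_mod_tangent[OF \<mu> \<eta>' le' \<psi>, of \<phi>] by (auto simp: min_def split: if_splits)
    have \<psi>0: "\<psi> \<noteq> 0" by (rule tangent_nonzero[OF \<mu> \<eta>' le' \<psi>])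
    \<comment> \<open>\<open>\<mu>\<close> and \<open>\<eta>'\<close> agree on constants. A
      nonconstant \<open>\<psi>\<close> makes the degree of the quotient smaller than that of
      \<open>\<phi>\<close>.\<close>
    have "degree \<psi> > 0"
    proof (rule ccontr)
      assume "\<not> degree \<psi> > 0"
      then obtain c where "\<psi> = [:c:]" by (metis degree_eq_zeroE gr0I)
      then have "?\<mu> \<psi> = \<eta>' \<psi>" using \<mu> \<eta>' by (simp add: valuations_over_def)
      then show False using tangent_less[OF \<mu> \<eta>' le' \<psi>] by simp
    qed
    then have q_deg: "degree ?q < degree \<phi>"
      using deg by (simp add: degree_div_less)
    have "degree (\<phi> mod \<psi>) < degree \<phi>"
      using degree_mod_less[OF \<psi>0, of \<phi>] deg by auto
    then have eq: "?\<mu> ?q = \<eta> ?q" "?\<mu> \<psi> = \<eta> \<psi>" "?\<mu> (\<phi> mod \<psi>) = \<eta> (\<phi> mod \<psi>)"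
      using eq_below_tangent_degree[OF \<mu> \<eta> le \<phi>] q_deg deg by blast+
    \<comment> \<open>Under \<open>\<eta>\<close> both \<open>\<phi>\<close> and the remainder lie
      above \<open>?\<mu> \<phi>\<close>, hence so does the multiple of \<open>\<psi>\<close>; but
      \<open>\<eta>\<close> agrees with \<open>?\<mu>\<close> on its two factors.\<close>
    have "?\<mu> \<phi> < \<eta> (\<phi> - \<phi> mod \<psi>)"
      using less mod_less eq(3) by (intro \<eta>.diff_less) simp_all
    also have "\<phi> - \<phi> mod \<psi> = ?q * \<psi>" by (rule minus_mod_eq_div_mult)
    also have "\<eta> (?q * \<psi>) = ?\<mu> \<phi>" unfolding q_val \<mu>.mult \<eta>.mult eq ..
    finally show False by simp
  qed
  then have "tangent_direction ?\<mu> \<eta> = tangent_direction ?\<mu> \<eta>'"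
    using tangent_direction_eqI[OF \<mu> \<eta> \<eta>' le le' \<phi>] by blast
  also have "\<dots> = key_polys r \<delta>"
    unfolding \<mu>_r \<eta>'_def by (rule tangent_direction_rv[OF \<delta>])
  finally show ?thesis using r(1) by blast
qed

section \<open>Conjugacy of open balls\<close>

text \<open>A nonzero remainder has too small a degree to have a root in the open ball, so
  \<open>mv_eq_v_poly\<close> applies to it. The right-hand side depends on \<open>c\<close> only
  through its minimal polynomial.\<close>

lemma v_poly_Min_over:
  assumes c: "c \<in> vcball v a \<delta>" "c \<in> Min_over h (voball v c \<delta>)"
  shows "v (poly (H q) c) = rv a \<delta> (q mod minpoly h c)"
proof -
  let ?r = "q mod minpoly h c"
  have "poly (H q) c = poly (H (q div minpoly h c * minpoly h c + ?r)) c"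
    by (simp only: div_mult_mod_eq)
  also have "\<dots> = poly (H ?r) c" by (simp only: H_add H_mult poly_add poly_mult minpoly_root) simp
  finally have q: "poly (H q) c = poly (H ?r) c" .
  show ?thesis
  proof (cases "?r = 0")
    case True
    then show ?thesis using q by (simp add: restrict_val_def)
  next
    case False
    have "degree ?r < degree (minpoly h c)"
      using degree_mod_less[OF minpoly_nonzero[of c], of q] False by blast
    then have "poly (H ?r) d \<noteq> 0" if "d \<in> voball v c \<delta>" for d
      using minpoly_minimal[OF False, of d] c(2) that by (force simp: Min_over_iff deg_over_def)
    then have "mv c \<delta> (H ?r) = v (poly (H ?r) c)" by (rule mv_eq_v_poly)
    then show ?thesis
      using q rv_center[OF c(1)] by (simp add: restrict_val_def)
  qed
qed

lemma decomposition_groupD: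
  assumes "\<sigma> \<in> decomposition_group h v"
  shows "bij \<sigma>" "\<sigma> (x + y) = \<sigma> x + \<sigma> y" "\<sigma> (x * y) = \<sigma> x * \<sigma> y" "\<sigma> (h k) = h k" "v (\<sigma> x) = v x"
    "\<sigma> (x - y) = \<sigma> x - \<sigma> y"
proof -
  show "bij \<sigma>" "\<sigma> (x * y) = \<sigma> x * \<sigma> y" "\<sigma> (h k) = h k"
    and add: "\<sigma> (x + y) = \<sigma> x + \<sigma> y" for x y
    using assms by (simp_all add: decomposition_group_def)
  show "\<sigma> (x - y) = \<sigma> x - \<sigma> y"
    using add[of "x - y" y] by (simp add: algebra_simps)
  have "v \<circ> \<sigma> = v" using assms by (simp add: decomposition_group_def)
  then show "v (\<sigma> x) = v x" by (metis comp_apply)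
qed

lemma voball_image:
  assumes \<sigma>: "\<sigma> \<in> decomposition_group h v"
  shows "\<sigma> ` voball v c \<delta> = voball v (\<sigma> c) \<delta>"
proof -
  note D = decomposition_groupD[OF \<sigma>]
  have iff: "\<sigma> b \<in> voball v (\<sigma> c) \<delta> \<longleftrightarrow> b \<in> voball v c \<delta>" for b
    by (simp add: voball_def D(5) flip: D(6))
  show ?thesis
  proof (intro equalityI subsetI)
    fix y assume "y \<in> voball v (\<sigma> c) \<delta>"
    moreover obtain b where "y = \<sigma> b" using D(1) by (metis bij_pointE)
    ultimately show "y \<in> \<sigma> ` voball v c \<delta>" using iff by blast
  qed (use iff in auto)
qed

text \<open>\<open>\<sigma>\<close> fixes \<open>K\<close> and so commutes with evaluating
  polynomials over \<open>K\<close>; \<open>c\<close> and \<open>\<sigma> c\<close> are roots of the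
  same ones.\<close>

lemma decomposition_group_minpoly:
  assumes \<sigma>: "\<sigma> \<in> decomposition_group h v"
  shows "minpoly h (\<sigma> c) = minpoly h c"
proof -
  note D = decomposition_groupD[OF \<sigma>]
  have "\<sigma> 0 = 0" using D(4)[of 0] by simp
  have poly: "poly (H q) (\<sigma> c) = \<sigma> (poly (H q) c)" for q
    by (induction q) (simp_all add: D(2-4) \<open>\<sigma> 0 = 0\<close>)
  have "poly (H q) (\<sigma> c) = 0 \<longleftrightarrow> poly (H q) c = 0" for q
    unfolding poly using D(1) \<open>\<sigma> 0 = 0\<close> by (metis bij_pointE)
  then show ?thesis
    by (intro minpoly_eqI) (auto intro: minpoly_minimal)
qed

lemma key_polys_conjugate:
  assumes \<sigma>: "\<sigma> \<in> decomposition_group h v" and "voball v d \<delta> = \<sigma> ` voball v c \<delta>"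
  shows "key_polys d \<delta> = key_polys c \<delta>"
proof -
  have "Min_over h (\<sigma> ` voball v c \<delta>) = \<sigma> ` Min_over h (voball v c \<delta>)"
    using decomposition_group_minpoly[OF \<sigma>] by (auto simp: Min_over_iff deg_over_def)
  then show ?thesis
    by (simp add: key_polys_def assms(2) image_image decomposition_group_minpoly[OF \<sigma>])
qed

lemma conjugate_if_key_polys_eq:
  assumes c: "c \<in> vcball v a \<delta>" and d: "d \<in> vcball v a \<delta>"
    and eq: "key_polys c \<delta> = key_polys d \<delta>"
  shows "\<exists>\<sigma>\<in>decomposition_group h v. voball v d \<delta> = \<sigma> ` voball v c \<delta>"
proof -
  obtain x where x: "x \<in> Min_over h (voball v c \<delta>)"
    using Min_over_nonempty[OF center_in_voball] by blast
  then have "minpoly h x \<in> key_polys d \<delta>" using eq by (auto simp: key_polys_def)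
  then obtain y where y: "y \<in> Min_over h (voball v d \<delta>)" and xy: "minpoly h x = minpoly h y"
    by (auto simp: key_polys_def)
  have balls: "voball v x \<delta> = voball v c \<delta>" "voball v y \<delta> = voball v d \<delta>"
    using x y by (simp_all add: Min_over_iff voball_center)
  have in_ball: "x \<in> vcball v a \<delta>" "y \<in> vcball v a \<delta>"
    using x y voball_subset_vcball[OF c] voball_subset_vcball[OF d] by (auto simp: Min_over_iff)
  \<comment> \<open>Both sides are the value under \<open>rv a \<delta>\<close> of the same
    remainder.\<close>
  have v_eq: "v (poly (H q) x) = v (poly (H q) y)" for q
    using v_poly_Min_over[OF in_ball(1)] v_poly_Min_over[OF in_ball(2)] x y balls xy by simp
  \<comment> \<open>The graph of the map over \<open>K\<close> sending \<open>x\<close> to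
    \<open>y\<close>; being isometric makes it single-valued.\<close>
  define S where "S = range (\<lambda>q. (poly (H q) x, poly (H q) y))"
  have S: "(poly (H q) x, poly (H q) y) \<in> S" for q
    by (simp add: S_def)
  have "isometric_graph S"
    unfolding isometric_graph_def ring_graph_def
  proof (intro conjI allI impI)
    show "(h k, h k) \<in> S" for k using S[of "[:k:]"] by simp
    show "v z = v z'" if "(z, z') \<in> S" for z z' using that v_eq by (auto simp: S_def)
    fix z z' w w' assume "(z, z') \<in> S" "(w, w') \<in> S"
    then obtain p q where "z = poly (H p) x" "z' = poly (H p) y" "w = poly (H q) x" "w' = poly (H q) y"
      by (auto simp: S_def)
    then show "(z + w, z' + w') \<in> S" "(z * w, z' * w') \<in> S"
      using S[of "p + q"] S[of "p * q"] by (simp_all add: H_add H_mult)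
  qed
  then obtain \<sigma> where \<sigma>: "\<sigma> \<in> decomposition_group h v" "\<And>z z'. (z, z') \<in> S \<Longrightarrow> \<sigma> z = z'"
    using isometric_graph_extends_to_automorphism by blast
  have "\<sigma> x = y" using \<sigma>(2)[OF S[of "[:0, 1:]"]] by simp
  then have "voball v d \<delta> = \<sigma> ` voball v c \<delta>"
    using voball_image[OF \<sigma>(1), of x \<delta>] balls by simp
  then show ?thesis using \<sigma>(1) by blast
qed

end

text \<open>\<open>I // R\<close> is the quotient of the index set. \<open>the_elem\<close> extracts
  the common value of \<open>KP\<close> on a class, which \<open>KP respects R\<close> makes
  meaningful.\<close>

theorem mainTheorem8:
  fixes h :: "'k::field \<Rightarrow> 'l::alg_closed_field"
    and v :: "'l \<Rightarrow> 'g::linordered_ab_group_add with_inf"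
    and a :: 'l and \<delta> :: 'g
    and \<mu> :: "'k poly \<Rightarrow> 'g with_inf"
    and I :: "'i set" and c :: "'i \<Rightarrow> 'l"
    and R :: "('i \<times> 'i) set"
    and KP :: "'i \<Rightarrow> 'k poly set"
  assumes closure: "is_alg_closure h"
    and val: "valuation v"
    and divisible: "divisible_group TYPE('g)"
    and nontrivial: "\<exists>\<gamma>::'g. \<gamma> \<noteq> 0"
    and partition: "vcball v a \<delta> = (\<Union>i\<in>I. voball v (c i) \<delta>)"
      "disjoint_family_on (\<lambda>i. voball v (c i) \<delta>) I"
  defines "\<mu> \<equiv> restrict_val h (monomial_val v a \<delta>)"
    and "R \<equiv> {(i, j). i \<in> I \<and> j \<in> I \<and>
               (\<exists>\<sigma>\<in>decomposition_group h v. voball v (c j) \<delta> = \<sigma> ` voball v (c i) \<delta>)}"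
    and "KP \<equiv> \<lambda>i. minpoly h ` Min_over h (voball v (c i) \<delta>)"
  shows "\<mu> \<in> valuations_over h v \<and> equiv I R \<and> KP respects R \<and>
    bij_betw (\<lambda>X. the_elem (KP ` X)) (I // R)
      {tangent_direction \<mu> \<eta> | \<eta>. \<eta> \<in> valuations_over h v \<and> \<mu> < \<eta>}"
proof -
  interpret valued_closure h v
    by unfold_locales (fact closure, fact val)
  have KP: "KP i = key_polys (c i) \<delta>" for i
    by (simp add: KP_def key_polys_def)
  have in_ball: "c i \<in> vcball v a \<delta>" if "i \<in> I" for i
    using partition(1) that center_in_voball[of "c i"] by blast
  \<comment> \<open>Conjugacy of balls becomes equality of \<open>KP\<close>, from which the
    equivalence relation and injectivity follow at once.\<close>
  have R_iff: "(i, j) \<in> R \<longleftrightarrow> i \<in> I \<and> j \<in> I \<and> KP i = KP j" for i j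
    unfolding R_def KP using key_polys_conjugate conjugate_if_key_polys_eq[OF in_ball in_ball] by blast
  \<comment> \<open>A nontrivial value group contains a larger radius: one of
    \<open>\<delta> + \<gamma>\<close> and \<open>\<delta> - \<gamma>\<close>.\<close>
  obtain \<epsilon> where \<epsilon>: "\<delta> < \<epsilon>"
  proof -
    obtain \<gamma> :: 'g where "\<gamma> \<noteq> 0" using nontrivial by blast
    then have "\<delta> < \<delta> + \<gamma> \<or> \<delta> < \<delta> - \<gamma>" by auto
    then show ?thesis using that by blast
  qed
  have \<mu>: "\<mu> \<in> valuations_over h v"
    unfolding \<mu>_def by (rule rv_in_valuations_over)
  have equiv: "equiv I R"
    by (rule equivI) (auto simp: refl_on_def sym_def trans_def R_iff)
  have respects: "KP respects R"
    by (rule congruentI) (simp add: R_iff)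
  let ?T = "{tangent_direction \<mu> \<eta> | \<eta>. \<eta> \<in> valuations_over h v \<and> \<mu> < \<eta>}"
  have image: "KP ` I = ?T"
  proof (intro equalityI subsetI)
    fix X assume "X \<in> KP ` I"
    then obtain i where i: "i \<in> I" "X = KP i" by blast
    define \<eta> where "\<eta> = rv (c i) \<epsilon>"
    have \<mu>_i: "\<mu> = rv (c i) \<delta>" unfolding \<mu>_def by (rule rv_center[OF in_ball[OF i(1)]])
    have "X = tangent_direction \<mu> \<eta>"
      unfolding \<mu>_i \<eta>_def i(2) KP by (rule tangent_direction_rv[OF \<epsilon>, symmetric])
    moreover have "\<eta> \<in> valuations_over h v" unfolding \<eta>_def by (rule rv_in_valuations_over)
    moreover have "\<mu> \<le> \<eta>"
      unfolding \<mu>_i \<eta>_def le_fun_def using \<epsilon> by (intro allI rv_mono) simp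
    \<comment> \<open>The minimal polynomial of the centre has a root in the open ball and so
      witnesses \<open>\<mu> \<noteq> \<eta>\<close>.\<close>
    moreover have "\<mu> (minpoly h (c i)) < \<eta> (minpoly h (c i))"
      unfolding \<mu>_i \<eta>_def rv_less_iff[OF \<epsilon>]
      by (intro conjI bexI[of _ "c i"] minpoly_root center_in_voball minpoly_nonzero)
    ultimately show "X \<in> ?T"
      by (auto simp: less_le)
  next
    fix X assume "X \<in> ?T"
    then obtain \<eta> where \<eta>: "\<eta> \<in> valuations_over h v" "\<mu> < \<eta>" "X = tangent_direction \<mu> \<eta>"
      by blast
    have "\<mu> f \<le> \<eta> f" for f using \<eta>(2) by (simp add: less_le le_fun_def)
    moreover have "\<mu> \<noteq> \<eta>" using \<eta>(2) by blast
    ultimately obtain r where r: "r \<in> vcball v a \<delta>" "X = key_polys r \<delta>"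
      using tangent_direction_is_key_polys[OF \<epsilon> \<eta>(1), of a] unfolding \<eta>(3) \<mu>_def by blast
    then obtain i where i: "i \<in> I" "r \<in> voball v (c i) \<delta>" using partition(1) by blast
    then have "X = KP i" unfolding KP r(2) key_polys_def using voball_center by simp
    then show "X \<in> KP ` I" using i(1) by blast
  qed
  have class_image: "the_elem (KP ` (R `` {i})) = KP i" if "i \<in> I" for i
  proof -
    have "KP ` (R `` {i}) = {KP i}" using that R_iff by auto
    then show ?thesis by simp
  qed
  have "bij_betw (\<lambda>X. the_elem (KP ` X)) (I // R) ?T"
    unfolding bij_betw_def
  proof
    show "inj_on (\<lambda>X. the_elem (KP ` X)) (I // R)"
    proof (rule inj_onI)
      fix X Y assume "X \<in> I // R" "Y \<in> I // R" and eq: "the_elem (KP ` X) = the_elem (KP ` Y)"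
      then obtain i j where ij: "i \<in> I" "j \<in> I" "X = R `` {i}" "Y = R `` {j}"
        by (auto elim!: quotientE)
      then have "(i, j) \<in> R" using eq class_image R_iff by simp
      then show "X = Y" using equiv_class_eq[OF equiv] ij by blast
    qed
    have "(\<lambda>X. the_elem (KP ` X)) ` (I // R) = KP ` I"
      using class_image by (force simp: quotient_def)
    then show "(\<lambda>X. the_elem (KP ` X)) ` (I // R) = ?T" using image by simp
  qed
  then show ?thesis using \<mu> equiv respects by blast
qed

end
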